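(* Let $n\ge 1$, $\gamma\in(0,1)$, $T>0$, $\tau>0$, $s>0$, $p>0$, $E>0$, $\delta>0$. Let $u$ be the solution of the final value problem $\partial_t^\gamma u=\Delta u$ on $\mathbb{R}^n\times(0,T)$, $u(\cdot,T)=g$, with $u(\cdot,0)\in H^p(\mathbb{R}^n)$ and $\|u(\cdot,0)\|_{H^p}\le E$. Let $g^\delta\in L^2(\mathbb{R}^n)$ satisfy $\|g-g^\delta\|_{L^2}\le\delta$, for $\alpha>0$ let $u_\alpha^\delta$ be the regularized solution associated with $g^\delta$ and $\alpha$, and set $\alpha(\delta)=(\delta/E)^{\frac1{p+2}}$. (i) For all $t\in(0,T]$ and all $l\in[0,p+2]$ such that $p+2-l\le s$, $$\big\|u(\cdot,t)-u_{\alpha(\delta)}^\delta(\cdot,t)\big\|_{H^l}\le\frac{C}{t^\gamma}\,E^{\frac{l}{p+2}}\,\delta^{1-\frac{l}{p+2}},$$ where $C$ is a constant independent of $\delta$ and $E$. (ii) Moreover, for all $t\in(0,T]$ and all $l\in[0,p]$ such that $p-l\le s$, $$\big\|u(\cdot,t)-u_{\alpha(\delta)}^\delta(\cdot,t)\big\|_{H^l}\le\tilde C\,E^{\frac{2+l}{p+2}}\,\delta^{\frac{p-l}{p+2}},$$ where $\tilde C$ is a constant independent of $\delta$, $E$ and $t$.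
   Context: The Fourier transform is $\widehat f(\xi)=(2\pi)^{-n/2}\int_{\mathbb{R}^n}f(x)e^{-ix\cdot\xi}\,dx$, and $\|f\|_{H^p}=\|(1+|\xi|^2)^{p/2}\widehat f\|_{L^2}$. $\partial_t^\gamma$ is the Caputo derivative $\partial_t^\gamma u(t)=\frac{1}{\Gamma(1-\gamma)}\int_0^t\frac{u'(r)}{(t-r)^\gamma}\,dr$. $E_{\gamma,1}(z)=\sum_{k\ge0}\frac{z^k}{\Gamma(\gamma k+1)}$ is the Mittag-Leffler function. A solution of $\partial_t^\gamma u=\Delta u$ is understood through its frequency representation $\widehat u(\xi,t)=\widehat u(\xi,0)\,E_{\gamma,1}(-|\xi|^2t^\gamma)$, $t\in[0,T]$ (transform in $x$); thus $\widehat g(\xi)=\widehat u(\xi,0)E_{\gamma,1}(-|\xi|^2T^\gamma)$ for $g=u(\cdot,T)$. The regularized solution $u_\alpha^\delta$ is defined by $$\widehat{u_\alpha^\delta}(\xi,t)=\frac{E_{\gamma,1}(-|\xi|^2t^\gamma)}{E_{\gamma,1}(-|\xi|^2T^\gamma)}\,e^{-\tau(\alpha|\xi|)^s}\,\widehat{g^\delta}(\xi),\qquad t\in[0,T].$$ Here $E>0$ (a bound on the Sobolev norm) is not to be confused with the function $E_{\gamma,1}$.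
   Formalization: For an arbitrary fixed M>0, δ ≤ M·E is assumed in (ii) and in (i) when l>0, and C, C̃ may depend on M; without a bound on δ/E the claim fails (u=g=0, low-frequency g^δ of norm δ, δ/E→∞). Case l=0 of (i) needs no such bound. *)

theory Defs
  imports "HOL-Analysis.Analysis"
begin

text \<open>Square-integrable functions are represented by Borel functions; elements of
  $L^2$ are equal when they agree almost everywhere.\<close>

definition L2_space :: "((real ^ 'n) \<Rightarrow> complex) set" where
  "L2_space = {f \<in> borel_measurable lborel. integrable lborel (\<lambda>x. (norm (f x))\<^sup>2)}"

definition L2_norm :: "((real ^ 'n) \<Rightarrow> complex) \<Rightarrow> real" where
  "L2_norm f = sqrt (LINT x|lborel. (norm (f x))\<^sup>2)"

definition fourier_integral :: "((real ^ 'n) \<Rightarrow> complex) \<Rightarrow> (real ^ 'n) \<Rightarrow> complex" where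
  "fourier_integral f \<xi> =
     of_real ((2 * pi) powr (- real CARD('n) / 2)) *
     (LINT x|lborel. f x * exp (- \<i> * of_real (x \<bullet> \<xi>)))"

text \<open>The Fourier integral need not converge for a function that is only
  square-integrable. The transform on $L^2$ is the Plancherel one: the $L^2$-limit of
  the Fourier integrals over balls of growing radius. The distance is measured by a
  nonnegative Lebesgue integral, so that a non-integrable difference has distance
  infinity, not $0$.\<close>

definition has_fourier_transform ::
  "((real ^ 'n) \<Rightarrow> complex) \<Rightarrow> ((real ^ 'n) \<Rightarrow> complex) \<Rightarrow> bool" where
  "has_fourier_transform f F \<longleftrightarrow> F \<in> L2_space \<and>
     ((\<lambda>R. \<integral>\<^sup>+ \<xi>. ennreal ((norm (fourier_integral (\<lambda>x. indicator (cball 0 R) x * f x) \<xi> - F \<xi>))\<^sup>2)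
        \<partial>lborel) \<longlongrightarrow> 0) at_top"

text \<open>For \<open>f \<in> L2_space\<close> the transform exists and is unique up to null sets; the
  choice below picks a representative.\<close>

definition fourier :: "((real ^ 'n) \<Rightarrow> complex) \<Rightarrow> (real ^ 'n) \<Rightarrow> complex" where
  "fourier f = (SOME F. has_fourier_transform f F)"

definition sobolev_weighted :: "real \<Rightarrow> ((real ^ 'n) \<Rightarrow> complex) \<Rightarrow> (real ^ 'n) \<Rightarrow> complex" where
  "sobolev_weighted p f \<xi> = of_real ((1 + (norm \<xi>)\<^sup>2) powr (p / 2)) * fourier f \<xi>"

text \<open>Only orders \<open>p \<ge> 0\<close> are meant: then $H^p$ is contained in $L^2$.\<close>

definition sobolev_space :: "real \<Rightarrow> ((real ^ 'n) \<Rightarrow> complex) set" where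
  "sobolev_space p = {f \<in> L2_space. sobolev_weighted p f \<in> L2_space}"

definition sobolev_norm :: "real \<Rightarrow> ((real ^ 'n) \<Rightarrow> complex) \<Rightarrow> real" where
  "sobolev_norm p f = L2_norm (sobolev_weighted p f)"

definition mittag_leffler :: "real \<Rightarrow> real \<Rightarrow> real \<Rightarrow> real" where
  "mittag_leffler a b z = (\<Sum>k. z ^ k / Gamma (a * real k + b))"

text \<open>Solutions on the time interval \<open>[0, T]\<close> of the diffusion equation with Caputo
  time derivative of order \<open>\<gamma>\<close>, in the frequency sense.\<close>

definition frac_diffusion_solution ::
  "real \<Rightarrow> real \<Rightarrow> ((real ^ 'n) \<Rightarrow> real \<Rightarrow> complex) \<Rightarrow> bool" where
  "frac_diffusion_solution \<gamma> T u \<longleftrightarrow>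
     (\<forall>t\<in>{0..T}. (\<lambda>x. u x t) \<in> L2_space \<and>
        (AE \<xi> in lborel. fourier (\<lambda>x. u x t) \<xi> =
           fourier (\<lambda>x. u x 0) \<xi> *
           of_real (mittag_leffler \<gamma> 1 (- ((norm \<xi>)\<^sup>2 * t powr \<gamma>)))))"

text \<open>The function \<open>v\<close> is the regularized solution for the data \<open>h\<close> and the
  parameter \<open>\<alpha>\<close>; its Fourier transform determines it up to null sets.\<close>

definition regularized_solution ::
  "real \<Rightarrow> real \<Rightarrow> real \<Rightarrow> real \<Rightarrow> real \<Rightarrow> ((real ^ 'n) \<Rightarrow> complex) \<Rightarrow>
     ((real ^ 'n) \<Rightarrow> real \<Rightarrow> complex) \<Rightarrow> bool" where
  "regularized_solution \<gamma> T \<tau> s \<alpha> h v \<longleftrightarrow>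
     (\<forall>t\<in>{0..T}. (\<lambda>x. v x t) \<in> L2_space \<and>
        (AE \<xi> in lborel. fourier (\<lambda>x. v x t) \<xi> =
           of_real (mittag_leffler \<gamma> 1 (- ((norm \<xi>)\<^sup>2 * t powr \<gamma>)) /
                    mittag_leffler \<gamma> 1 (- ((norm \<xi>)\<^sup>2 * T powr \<gamma>)) *
                    exp (- \<tau> * (\<alpha> * norm \<xi>) powr s)) * fourier h \<xi>))"

end

theory Submission
  imports Defs "HOL-Probability.Characteristic_Functions" "HOL-Real_Asymp.Real_Asymp"
begin

text \<open>In frequency space the error splits as
  \<open>e(t) (1 - \<rho>) u(0) + e(t) / e(T) \<rho> (g - g\<delta>)\<close>, where \<open>e(t) = E(- |\<xi>|^2 t^\<gamma>)\<close> is the Mittag-Leffler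
  factor and \<open>\<rho> = exp (- \<tau> (\<alpha> |\<xi>|)^s)\<close> the filter. Both terms are bounded pointwise by multiples of
  \<open>\<alpha>^(p + 2 - \<kappa>)\<close> and \<open>\<alpha>^(- \<kappa>)\<close>, which the choice of \<open>\<alpha>\<close> balances; \<open>\<kappa> = l\<close> gives (i) and
  \<open>\<kappa> = l + 2\<close> gives (ii). Two ingredients are needed.

  The bounds \<open>1 / (1 + \<Gamma>(1 - \<gamma>) x) \<le> E(- x) \<le> 1 / (1 + x / \<Gamma>(1 + \<gamma>))\<close> come from a discrete
  analogue of \<open>E(- x)\<close>, the Taylor coefficients \<open>y n\<close> of
  \<open>(1 - z)^(\<gamma> - 1) / ((1 - z)^\<gamma> + \<mu>)\<close>. They are decreasing in \<open>n\<close>, so the two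
  convolution identities obtained by clearing the denominator bound \<open>y n\<close> from both sides; with
  \<open>\<mu> = x / (n + 1)^\<gamma>\<close> Tannery's theorem yields \<open>y n \<longlonglongrightarrow> E(- x)\<close>.

  The Plancherel inequality is proved for integrable functions by Gaussian regularization and
  carries over to all square-integrable functions by completeness of \<open>L2\<close>.\<close>

subsection \<open>Power series coefficients\<close>

lemma summable_poly_geometric:
  fixes q :: real
  assumes "0 \<le> q" "q < 1"
  shows "summable (\<lambda>k. (1 + real k) ^ m * q ^ k)"
proof (cases "q = 0")
  case False
  with assms have q: "0 < q" by simp
  obtain r where r: "q < r" "r < 1" using dense assms by blast
  show ?thesis
  proof (rule summable_comparison_test_bigo)
    show "summable (\<lambda>k. norm (r ^ k))" using q r by (simp add: summable_geometric)
    show "(\<lambda>k. (1 + real k) ^ m * q ^ k) \<in> O(\<lambda>k. r ^ k)"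
      using q r by real_asymp
  qed
next
  case True
  then have "(\<lambda>k. (1 + real k) ^ m * q ^ k) = (\<lambda>k. if k = 0 then 1 else 0)"
    by (auto simp: fun_eq_iff)
  then show ?thesis by (simp only: summable_single)
qed

text \<open>The coefficient of \<open>z ^ n\<close> in the binomial series of
  \<open>(1 - z) powr (- a)\<close>, for \<open>a\<close> of either sign. The identities below are
  read off products of such series.\<close>

definition rising_coeff :: "real \<Rightarrow> nat \<Rightarrow> real" where
  "rising_coeff a n = pochhammer a n / fact n"

lemma rising_coeff_0 [simp]: "rising_coeff a 0 = 1"
  by (simp add: rising_coeff_def)

lemma rising_coeff_1_left [simp]: "rising_coeff 1 n = 1"
  by (simp add: rising_coeff_def pochhammer_fact [symmetric])

lemma rising_coeff_0_Suc [simp]: "rising_coeff 0 (Suc n) = 0"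
  by (simp add: rising_coeff_def pochhammer_rec)

text \<open>Cauchy product of the series of \<open>(1 - z) powr (- a)\<close> and
  \<open>(1 - z) powr (- b)\<close>, that is, Vandermonde's identity for rising factorials.\<close>

lemma rising_coeff_convolution:
  "rising_coeff (a + b) n = (\<Sum>j\<le>n. rising_coeff a j * rising_coeff b (n - j))"
proof -
  have "real (n choose j) / fact n = 1 / (fact j * fact (n - j))" if "j \<le> n" for j
    using that by (simp add: binomial_fact)
  then have "(real (n choose j) * u * v) / fact n = (u / fact j) * (v / fact (n - j))"
    if "j \<le> n" for j and u v :: real
    using that by (simp add: field_simps)
  then show ?thesis
    unfolding rising_coeff_def pochhammer_binomial_sum sum_divide_distrib
    by (intro sum.cong) auto
qed

lemma rising_coeff_sum: "(\<Sum>j\<le>n. rising_coeff a j) = rising_coeff (a + 1) n"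
  by (simp add: rising_coeff_convolution)

lemma rising_coeff_nonneg: "0 \<le> a \<Longrightarrow> 0 \<le> rising_coeff a n"
  by (cases "a = 0") (auto simp: rising_coeff_def pochhammer_nonneg pochhammer_0_left)

lemma rising_coeff_pos: "0 < a \<Longrightarrow> 0 < rising_coeff a n"
  by (simp add: rising_coeff_def pochhammer_pos)

text \<open>The first factor of the rising factorial is \<open>- c\<close>, all others are
  positive.\<close>

lemma rising_coeff_neg_Suc:
  assumes "0 < c" "c < 1"
  shows "rising_coeff (- c) (Suc n) \<le> 0"
proof -
  have "pochhammer (- c) (Suc n) = - (c * pochhammer (1 - c) n)"
    by (simp add: pochhammer_rec)
  with assms pochhammer_nonneg[of "1 - c" n] show ?thesis
    by (simp add: rising_coeff_def divide_nonpos_pos)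
qed

text \<open>Each factor \<open>(a + n) / (n + 1)\<close> is at most \<open>1 + a\<close>. For fixed
  \<open>n\<close> the bound is polynomial in \<open>a\<close>, so it can be summed against a
  geometric sequence.\<close>

lemma rising_coeff_le_power:
  assumes "0 \<le> a"
  shows "rising_coeff a n \<le> (1 + a) ^ n"
proof (induction n)
  case (Suc n)
  have "rising_coeff a (Suc n) = rising_coeff a n * ((a + real n) / real (Suc n))"
    by (simp add: rising_coeff_def pochhammer_Suc field_simps)
  also have "\<dots> \<le> (1 + a) ^ n * (1 + a)"
    using assms Suc by (intro mult_mono) (auto simp: field_simps)
  finally show ?case by (simp add: mult.commute)
qed simp

lemma rising_coeff_Pascal:
  "rising_coeff (a + 1) (Suc n) = rising_coeff (a + 1) n + rising_coeff a (Suc n)"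
  by (simp flip: rising_coeff_sum)

text \<open>Gauss's product for the reciprocal Gamma function, stated with \<open>Suc n\<close> so
  that it matches \<open>\<mu> = x / real (Suc n) powr \<gamma>\<close> later.\<close>

lemma rising_coeff_asymptotic:
  "(\<lambda>n. rising_coeff (a + 1) n / real (Suc n) powr a) \<longlonglongrightarrow> rGamma (a + 1)"
proof -
  have "(\<lambda>n. rGamma_series (a + 1) n * (real n / (a + 1 + real n) * (real n / real (Suc n)) powr a))
      \<longlonglongrightarrow> rGamma (a + 1) * 1"
    by (intro tendsto_mult rGamma_series_LIMSEQ) real_asymp
  moreover have "\<forall>\<^sub>F n in sequentially.
      rGamma_series (a + 1) n * (real n / (a + 1 + real n) * (real n / real (Suc n)) powr a)
      = rising_coeff (a + 1) n / real (Suc n) powr a"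
    \<comment> \<open>Beyond this index \<open>a + 1 + n\<close> is positive, so the extra factor of
      \<open>rGamma_series\<close> can be cancelled.\<close>
    using eventually_gt_at_top[of "nat \<lceil>\<bar>a + 1\<bar>\<rceil>"]
  proof eventually_elim
    case (elim n)
    then have n: "\<bar>a + 1\<bar> < real n" by linarith
    then have "0 < real n" "0 < a + 1 + real n" by linarith+
    moreover have "exp ((a + 1) * ln (real n)) = real n powr a * real n"
      using \<open>0 < real n\<close> by (simp add: powr_def distrib_right exp_add)
    moreover have "(real n / real (Suc n)) powr a = real n powr a / real (Suc n) powr a"
      by (simp add: powr_divide)
    ultimately show ?case
      by (simp add: rGamma_series_def rising_coeff_def pochhammer_Suc divide_simps)
  qed
  ultimately show ?thesis by (simp add: tendsto_cong)
qed

subsection \<open>A discrete Mittag-Leffler function\<close>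

text \<open>Coefficient of \<open>z ^ n\<close> in \<open>(1 - z) powr (\<gamma> - c) / ((1 - z)
  powr \<gamma> + \<mu>)\<close>, expanded as a geometric series in
  \<open>- \<mu> (1 - z) powr (- \<gamma>)\<close>. At \<open>z = 0\<close> the ratio is
  \<open>- \<mu>\<close>, hence the range \<open>\<mu> < 1\<close> below.\<close>

definition discrete_ml :: "real \<Rightarrow> real \<Rightarrow> real \<Rightarrow> nat \<Rightarrow> real" where
  "discrete_ml \<gamma> \<mu> c n = (\<Sum>k. (- \<mu>) ^ k * rising_coeff (\<gamma> * real k + c) n)"

context
  fixes \<gamma> \<mu> :: real
  assumes \<gamma>: "0 < \<gamma>" "\<gamma> < 1" and \<mu>: "0 \<le> \<mu>" "\<mu> < 1"
begin

lemma summable_discrete_ml_nonneg: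
  assumes "0 \<le> c"
  shows "summable (\<lambda>k. (- \<mu>) ^ k * rising_coeff (\<gamma> * real k + c) n)"
proof (rule summable_comparison_test')
  show "summable (\<lambda>k. (1 + c) ^ n * ((1 + real k) ^ n * \<mu> ^ k))"
    by (intro summable_mult summable_poly_geometric \<mu>)
  fix k :: nat
  have "\<gamma> * real k \<le> real k" using \<gamma> by (simp add: mult_left_le_one_le)
  moreover have "0 \<le> c * real k" using assms by simp
  ultimately have *: "1 + (\<gamma> * real k + c) \<le> (1 + c) * (1 + real k)"
    by (simp add: algebra_simps)
  have "rising_coeff (\<gamma> * real k + c) n \<le> (1 + (\<gamma> * real k + c)) ^ n"
    using \<gamma> assms by (intro rising_coeff_le_power) simp
  also have "\<dots> \<le> ((1 + c) * (1 + real k)) ^ n"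
    using \<gamma> assms * by (intro power_mono) auto
  finally have "rising_coeff (\<gamma> * real k + c) n \<le> (1 + c) ^ n * (1 + real k) ^ n"
    by (simp add: power_mult_distrib)
  moreover have "0 \<le> rising_coeff (\<gamma> * real k + c) n"
    using \<gamma> assms by (intro rising_coeff_nonneg) simp
  ultimately show "norm ((- \<mu>) ^ k * rising_coeff (\<gamma> * real k + c) n)
      \<le> (1 + c) ^ n * ((1 + real k) ^ n * \<mu> ^ k)"
    using \<mu> mult_left_mono[of "rising_coeff (\<gamma> * real k + c) n" "(1 + c) ^ n * (1 + real k) ^ n" "\<mu> ^ k"]
    by (simp add: abs_mult power_abs mult_ac)
qed

text \<open>Multiplication of the generating function by \<open>(1 - z) powr (- b)\<close>. The
  \<open>sums\<close> form carries convergence as well, and \<open>b\<close> may be negative; this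
  extends summability to every real \<open>c\<close>.\<close>

lemma discrete_ml_convolution_sums:
  assumes "0 \<le> c"
  shows "(\<lambda>k. (- \<mu>) ^ k * rising_coeff (\<gamma> * real k + (b + c)) n) sums
    (\<Sum>j\<le>n. rising_coeff b j * discrete_ml \<gamma> \<mu> c (n - j))"
proof -
  have "(\<lambda>k. \<Sum>j\<le>n. rising_coeff b j * ((- \<mu>) ^ k * rising_coeff (\<gamma> * real k + c) (n - j))) sums
    (\<Sum>j\<le>n. rising_coeff b j * discrete_ml \<gamma> \<mu> c (n - j))"
    unfolding discrete_ml_def
    by (intro sums_sum sums_mult summable_sums summable_discrete_ml_nonneg assms)
  moreover have "(\<Sum>j\<le>n. rising_coeff b j * ((- \<mu>) ^ k * rising_coeff (\<gamma> * real k + c) (n - j)))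
      = (- \<mu>) ^ k * rising_coeff (\<gamma> * real k + (b + c)) n" for k
  proof -
    have "\<gamma> * real k + (b + c) = b + (\<gamma> * real k + c)" by simp
    then show ?thesis
      by (simp only: rising_coeff_convolution sum_distrib_left) (simp add: mult_ac)
  qed
  ultimately show ?thesis by simp
qed

lemma discrete_ml_convolution:
  assumes "0 \<le> c"
  shows "discrete_ml \<gamma> \<mu> (b + c) n = (\<Sum>j\<le>n. rising_coeff b j * discrete_ml \<gamma> \<mu> c (n - j))"
  using discrete_ml_convolution_sums[OF assms] unfolding discrete_ml_def[of \<gamma> \<mu> "b + c"]
  by (rule sums_unique[symmetric])

lemma summable_discrete_ml:
  "summable (\<lambda>k. (- \<mu>) ^ k * rising_coeff (\<gamma> * real k + c) n)"
  using discrete_ml_convolution_sums[of 0 c] by (simp add: sums_iff)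

text \<open>The term \<open>k = 0\<close> is split off; for generating functions this is clearing
  the denominator \<open>1 + \<mu> (1 - z) powr (- \<gamma>)\<close>.\<close>

lemma discrete_ml_unfold:
  "discrete_ml \<gamma> \<mu> c n = rising_coeff c n - \<mu> * discrete_ml \<gamma> \<mu> (\<gamma> + c) n"
proof -
  have "discrete_ml \<gamma> \<mu> c n = rising_coeff c n +
      (\<Sum>k. (- \<mu>) ^ Suc k * rising_coeff (\<gamma> * real (Suc k) + c) n)"
    unfolding discrete_ml_def by (subst suminf_split_head[OF summable_discrete_ml]) simp
  also have "(\<lambda>k. (- \<mu>) ^ Suc k * rising_coeff (\<gamma> * real (Suc k) + c) n) =
      (\<lambda>k. (- \<mu>) * ((- \<mu>) ^ k * rising_coeff (\<gamma> * real k + (\<gamma> + c)) n))"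
    by (auto simp: fun_eq_iff algebra_simps)
  also have "suminf \<dots> = (- \<mu>) * discrete_ml \<gamma> \<mu> (\<gamma> + c) n"
    unfolding discrete_ml_def by (rule suminf_mult[OF summable_discrete_ml])
  finally show ?thesis by simp
qed

text \<open>The values at \<open>c = \<gamma>\<close> are the Taylor coefficients of \<open>1 / ((1 - z) powr \<gamma> + \<mu>)\<close>,
  and \<open>(1 - z) powr \<gamma>\<close> has nonpositive coefficients except for the constant one.\<close>

lemma discrete_ml_\<gamma>_nonneg: "0 \<le> discrete_ml \<gamma> \<mu> \<gamma> n"
proof (induction n rule: less_induct)
  case (less n)
  let ?a = "discrete_ml \<gamma> \<mu> \<gamma>"
  have "(\<Sum>j\<le>n. rising_coeff (- \<gamma>) j * ?a (n - j)) = discrete_ml \<gamma> \<mu> (- \<gamma> + \<gamma>) n"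
    using \<gamma> by (intro discrete_ml_convolution[symmetric]) simp
  also have "\<dots> = rising_coeff 0 n - \<mu> * ?a n"
    using discrete_ml_unfold[of 0 n] by simp
  finally have eq: "(\<Sum>j\<le>n. rising_coeff (- \<gamma>) j * ?a (n - j)) = rising_coeff 0 n - \<mu> * ?a n" .
  have "(\<Sum>j\<in>{..n} - {0}. rising_coeff (- \<gamma>) j * ?a (n - j)) \<le> 0"
  proof (rule sum_nonpos)
    fix j assume "j \<in> {..n} - {0}"
    then obtain i where "j = Suc i" "n - j < n" by (cases j) auto
    then show "rising_coeff (- \<gamma>) j * ?a (n - j) \<le> 0"
      using less rising_coeff_neg_Suc[OF \<gamma>, of i] by (simp add: mult_nonpos_nonneg)
  qed
  \<comment> \<open>The term \<open>j = 0\<close> of the convolution is \<open>?a n\<close> itself;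
    it joins \<open>\<mu> * ?a n\<close>, and only values at smaller indices remain in the
    sum.\<close>
  with eq have "rising_coeff 0 n \<le> (1 + \<mu>) * ?a n"
    by (simp add: sum.remove[of _ "0::nat"] distrib_right)
  moreover have "0 \<le> rising_coeff 0 n" by (simp add: rising_coeff_nonneg)
  ultimately have "0 \<le> (1 + \<mu>) * ?a n" by linarith
  then show ?case using \<mu> by (simp add: zero_le_mult_iff)
qed

text \<open>Multiplying by \<open>1 - z\<close> gives first differences: the increment is the
  coefficient for \<open>c = 0\<close>, which at a positive index equals \<open>- \<mu>\<close>
  times the nonnegative coefficient for \<open>c = \<gamma>\<close>.\<close>

lemma discrete_ml_1_antimono:
  assumes "m \<le> n"
  shows "discrete_ml \<gamma> \<mu> 1 n \<le> discrete_ml \<gamma> \<mu> 1 m"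
  using assms
proof (induction rule: dec_induct)
  case (step n)
  have "(\<lambda>k. (- \<mu>) ^ k * rising_coeff (\<gamma> * real k + 1) (Suc n)) =
     (\<lambda>k. (- \<mu>) ^ k * rising_coeff (\<gamma> * real k + 1) n
        + (- \<mu>) ^ k * rising_coeff (\<gamma> * real k + 0) (Suc n))"
    by (simp add: rising_coeff_Pascal distrib_left)
  then have "discrete_ml \<gamma> \<mu> 1 (Suc n) = discrete_ml \<gamma> \<mu> 1 n + discrete_ml \<gamma> \<mu> 0 (Suc n)"
    unfolding discrete_ml_def by (simp only: suminf_add[OF summable_discrete_ml summable_discrete_ml])
  also have "discrete_ml \<gamma> \<mu> 0 (Suc n) \<le> 0"
    using discrete_ml_unfold[of 0 "Suc n"] discrete_ml_\<gamma>_nonneg[of "Suc n"] \<mu> by simp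
  finally show ?case using step by simp
qed simp

text \<open>Convolving with the nonnegative weights \<open>rising_coeff \<gamma>\<close> and using
  \<open>?y (n - j) \<ge> ?y n\<close> bounds the coefficient for \<open>\<gamma> + 1\<close> from
  below by \<open>?y n\<close> times the total weight.\<close>

lemma discrete_ml_1_le: "discrete_ml \<gamma> \<mu> 1 n \<le> 1 / (1 + \<mu> * rising_coeff (\<gamma> + 1) n)"
proof -
  let ?y = "discrete_ml \<gamma> \<mu> 1"
  have "?y n * rising_coeff (\<gamma> + 1) n = (\<Sum>j\<le>n. rising_coeff \<gamma> j * ?y n)"
    by (simp flip: rising_coeff_sum add: sum_distrib_right mult.commute)
  also have "\<dots> \<le> (\<Sum>j\<le>n. rising_coeff \<gamma> j * ?y (n - j))"
    using \<gamma> by (intro sum_mono mult_left_mono discrete_ml_1_antimono rising_coeff_nonneg) auto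
  also have "\<dots> = discrete_ml \<gamma> \<mu> (\<gamma> + 1) n"
    by (rule discrete_ml_convolution[symmetric]) simp
  finally have "\<mu> * (?y n * rising_coeff (\<gamma> + 1) n) \<le> \<mu> * discrete_ml \<gamma> \<mu> (\<gamma> + 1) n"
    using \<mu> by (intro mult_left_mono)
  also have "\<dots> = 1 - ?y n"
    using discrete_ml_unfold[of 1 n] by simp
  finally have "?y n * (1 + \<mu> * rising_coeff (\<gamma> + 1) n) \<le> 1"
    by (simp add: distrib_left mult_ac)
  moreover have "0 \<le> \<mu> * rising_coeff (\<gamma> + 1) n"
    using \<gamma> \<mu> by (simp add: rising_coeff_nonneg)
  ultimately show ?thesis by (simp add: pos_le_divide_eq)
qed

text \<open>The same comparison with the weights of \<open>(1 - z) powr \<gamma>\<close>: past index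
  0 they are nonpositive, and at index 0 both sides agree, so the sum is now bounded from
  above.\<close>

lemma discrete_ml_1_ge: "1 / (1 + \<mu> / rising_coeff (1 - \<gamma>) n) \<le> discrete_ml \<gamma> \<mu> 1 n"
proof -
  let ?y = "discrete_ml \<gamma> \<mu> 1" and ?d = "rising_coeff (1 - \<gamma>) n"
  have d: "0 < ?d" using \<gamma> by (simp add: rising_coeff_pos)
  \<comment> \<open>With \<open>c = 1 - \<gamma>\<close> the shifted parameter
    \<open>\<gamma> + c\<close> is 1, so \<open>?y\<close> appears on both sides.\<close>
  have "?d - \<mu> * ?y n = discrete_ml \<gamma> \<mu> (- \<gamma> + 1) n"
    using discrete_ml_unfold[of "1 - \<gamma>" n] by simp
  also have "\<dots> = (\<Sum>j\<le>n. rising_coeff (- \<gamma>) j * ?y (n - j))"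
    by (rule discrete_ml_convolution) simp
  also have "\<dots> \<le> (\<Sum>j\<le>n. rising_coeff (- \<gamma>) j * ?y n)"
  proof (rule sum_mono)
    fix j assume "j \<in> {..n}"
    show "rising_coeff (- \<gamma>) j * ?y (n - j) \<le> rising_coeff (- \<gamma>) j * ?y n"
    proof (cases j)
      case (Suc i)
      then show ?thesis
        using rising_coeff_neg_Suc[OF \<gamma>] discrete_ml_1_antimono[of "n - j" n]
        by (intro mult_left_mono_neg) auto
    qed simp
  qed
  also have "\<dots> = ?d * ?y n"
    using rising_coeff_sum[of "- \<gamma>" n] by (simp flip: sum_distrib_right)
  finally have "?d \<le> ?y n * (?d + \<mu>)" by (simp add: algebra_simps)
  moreover have "1 / (1 + \<mu> / ?d) = ?d / (?d + \<mu>)" using d \<mu> by (simp add: field_simps)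
  ultimately show ?thesis using d \<mu> by (simp add: pos_divide_le_eq)
qed

end

subsection \<open>Bounds for the Mittag-Leffler function\<close>

lemma one_plus_mult_le_powr:
  fixes a h :: real
  assumes "1 \<le> a" "0 \<le> h"
  shows "1 + a * h \<le> (1 + h) powr a"
proof -
  have "(\<lambda>h. (1 + h) powr a - a * h) 0 \<le> (\<lambda>h. (1 + h) powr a - a * h) h"
  proof (rule DERIV_nonneg_imp_nondecreasing[OF assms(2)])
    fix x :: real assume x: "0 \<le> x" "x \<le> h"
    have "((\<lambda>h. (1 + h) powr a - a * h) has_real_derivative a * (1 + x) powr (a - 1) - a) (at x)"
      using x by (auto intro!: derivative_eq_intros)
    moreover have "1 \<le> (1 + x) powr (a - 1)"
      using assms x by (intro ge_one_powr_ge_zero) auto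
    then have "0 \<le> a * (1 + x) powr (a - 1) - a"
      using assms by simp
    ultimately show "\<exists>y. ((\<lambda>h. (1 + h) powr a - a * h) has_real_derivative y) (at x) \<and> 0 \<le> y"
      by blast
  qed
  then show ?thesis by simp
qed

text \<open>Passing from \<open>n\<close> to \<open>n + 1\<close> multiplies the numerator by
  \<open>1 + a / (n + 1)\<close> and, after re-indexing, the denominator by
  \<open>(1 + 1 / (n + 1)) powr a\<close>, which is at least as large by Bernoulli's
  inequality.\<close>

lemma rising_coeff_ratio_antimono:
  assumes a: "1 \<le> a" and "N \<le> n"
  shows "rising_coeff (a + 1) n / real (Suc n) powr a \<le> rising_coeff (a + 1) N / real (Suc N) powr a"
  using assms(2)
proof (induction rule: dec_induct)
  case (step n)
  have "rising_coeff (a + 1) (Suc n) = rising_coeff (a + 1) n * (1 + a * (1 / real (Suc n)))"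
    by (simp add: rising_coeff_def pochhammer_Suc field_simps)
  also have "\<dots> \<le> rising_coeff (a + 1) n * (1 + 1 / real (Suc n)) powr a"
    using a by (intro mult_left_mono one_plus_mult_le_powr rising_coeff_nonneg) auto
  also have "1 + 1 / real (Suc n) = real (Suc (Suc n)) / real (Suc n)"
    by (simp add: field_simps)
  finally have "rising_coeff (a + 1) (Suc n) / real (Suc (Suc n)) powr a
      \<le> rising_coeff (a + 1) n / real (Suc n) powr a"
    by (simp add: powr_divide field_simps)
  with step show ?case by linarith
qed simp

text \<open>Fixing \<open>N\<close> makes the bound uniform in \<open>n\<close>: with
  \<open>a = \<gamma> k\<close> it is a polynomial in \<open>k\<close> times a geometric factor,
  which yields a summable majorant.\<close>

lemma rising_coeff_ratio_le:
  assumes "1 \<le> a" "N \<le> n"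
  shows "rising_coeff (a + 1) n / real (Suc n) powr a \<le> (2 + a) ^ N / real (Suc N) powr a"
proof -
  have "rising_coeff (a + 1) N \<le> (1 + (a + 1)) ^ N"
    using assms by (intro rising_coeff_le_power) simp
  then show ?thesis
    using rising_coeff_ratio_antimono[OF assms]
    by (smt (verit) divide_right_mono powr_ge_zero)
qed

lemma discrete_ml_tendsto:
  fixes \<gamma> x :: real
  assumes \<gamma>: "0 < \<gamma>" "\<gamma> < 1" and x: "0 < x"
  shows "(\<lambda>n. discrete_ml \<gamma> (x / real (Suc n) powr \<gamma>) 1 n) \<longlonglongrightarrow> mittag_leffler \<gamma> 1 (- x)"
proof -
  define R where "R a n = rising_coeff (a + 1) n / real (Suc n) powr a" for a n
  define a where "a k n = (- x) ^ k * R (\<gamma> * real k) n" for k n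
  have a_eq: "(- (x / real (Suc n) powr \<gamma>)) ^ k * rising_coeff (\<gamma> * real k + 1) n = a k n" for k n
  proof -
    have "real (Suc n) powr (\<gamma> * real k) = (real (Suc n) powr \<gamma>) ^ k"
      by (simp add: powr_realpow [symmetric] powr_powr)
    then show ?thesis
      by (simp add: a_def R_def power_divide flip: divide_minus_left)
  qed
  \<comment> \<open>\<open>N\<close> is fixed so that the majorant \<open>m\<close> has ratio
    \<open>q < 1\<close>; the factor \<open>2 ^ N\<close> in \<open>m\<close> comes from
    \<open>2 + \<gamma> k \<le> 2 (1 + k)\<close>.\<close>
  have "\<forall>\<^sub>F N in sequentially. x / real (Suc N) powr \<gamma> < 1"
    using \<gamma> by real_asymp
  then obtain N where N: "x / real (Suc N) powr \<gamma> < 1"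
    by (auto simp: eventually_sequentially)
  define q where "q = x / real (Suc N) powr \<gamma>"
  define m where "m k = 2 ^ N * ((1 + real k) ^ N * q ^ k)" for k
  have limit: "(\<lambda>n. a k n) \<longlonglongrightarrow> (- x) ^ k * rGamma (\<gamma> * real k + 1)" for k
    unfolding a_def R_def by (intro tendsto_intros rising_coeff_asymptotic)
  \<comment> \<open>The condition on \<open>k\<close> gives \<open>\<gamma> k \<ge> 1\<close>, as
    the monotone quotient requires. Tannery's theorem is used in the form that asks for domination
    only at large \<open>k\<close> and \<open>n\<close>.\<close>
  have bound: "norm (a k n) \<le> m k" if k: "nat \<lceil>1 / \<gamma>\<rceil> \<le> k" and n: "N \<le> n" for k n
  proof -
    have "1 / \<gamma> \<le> real k" using k by linarith
    then have k': "1 \<le> \<gamma> * real k" using \<gamma> by (simp add: field_simps)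
    have "R (\<gamma> * real k) n \<le> (2 + \<gamma> * real k) ^ N / real (Suc N) powr (\<gamma> * real k)"
      unfolding R_def by (rule rising_coeff_ratio_le[OF k' n])
    also have "real (Suc N) powr (\<gamma> * real k) = (real (Suc N) powr \<gamma>) ^ k"
      by (simp add: powr_realpow [symmetric] powr_powr)
    also have "(2 + \<gamma> * real k) ^ N \<le> (2 * (1 + real k)) ^ N"
      using \<gamma> mult_left_le_one_le[of "real k" \<gamma>] by (intro power_mono) (auto simp: algebra_simps)
    finally have R_le: "R (\<gamma> * real k) n \<le> 2 ^ N * (1 + real k) ^ N / (real (Suc N) powr \<gamma>) ^ k"
      unfolding power_mult_distrib by (simp add: divide_right_mono)
    have "0 \<le> R (\<gamma> * real k) n"
      using \<gamma> by (auto simp: R_def intro!: divide_nonneg_nonneg rising_coeff_nonneg)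
    then have "norm (a k n) = x ^ k * R (\<gamma> * real k) n"
      using x by (simp add: a_def abs_mult power_abs)
    also have "\<dots> \<le> x ^ k * (2 ^ N * (1 + real k) ^ N / (real (Suc N) powr \<gamma>) ^ k)"
      using x by (intro mult_left_mono R_le) simp
    also have "\<dots> = m k"
      by (simp add: m_def q_def power_divide)
    finally show ?thesis .
  qed
  have "summable m"
    unfolding m_def q_def using N x by (intro summable_mult summable_poly_geometric) auto
  have "eventually (\<lambda>(k, n). norm (a k n) \<le> m k) (sequentially \<times>\<^sub>F sequentially)"
    unfolding eventually_prod_sequentially using bound
    by (intro exI[of _ "max N (nat \<lceil>1 / \<gamma>\<rceil>)"]) auto
  from tannerys_theorem[OF limit this \<open>summable m\<close> sequentially_bot]
  have "(\<lambda>n. \<Sum>k. a k n) \<longlonglongrightarrow> (\<Sum>k. (- x) ^ k * rGamma (\<gamma> * real k + 1))"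
    by blast
  then show ?thesis
    unfolding discrete_ml_def a_eq by (simp add: mittag_leffler_def rGamma_inverse_Gamma divide_inverse)
qed

text \<open>The discrete bounds pass to the limit because \<open>rising_coeff\<close> grows like a
  power of \<open>n\<close> that matches the scaling of \<open>\<mu> n\<close>, with reciprocal
  Gamma values as constants.\<close>

lemma mittag_leffler_bounds:
  fixes \<gamma> x :: real
  assumes \<gamma>: "0 < \<gamma>" "\<gamma> < 1" and x: "0 \<le> x"
  shows "1 / (1 + x * Gamma (1 - \<gamma>)) \<le> mittag_leffler \<gamma> 1 (- x)"
    and "mittag_leffler \<gamma> 1 (- x) \<le> 1 / (1 + x / Gamma (1 + \<gamma>))"
proof -
  define \<mu> where "\<mu> n = x / real (Suc n) powr \<gamma>" for n
  have G: "0 < Gamma (1 - \<gamma>)" "0 < Gamma (1 + \<gamma>)"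
    using \<gamma> by (auto intro!: Gamma_real_pos)
  have "1 / (1 + x * Gamma (1 - \<gamma>)) \<le> mittag_leffler \<gamma> 1 (- x) \<and>
    mittag_leffler \<gamma> 1 (- x) \<le> 1 / (1 + x / Gamma (1 + \<gamma>))"
  proof (cases "x = 0")
    case True
    have "mittag_leffler \<gamma> 1 0 = 1"
      unfolding mittag_leffler_def
      by (subst suminf_finite[of "{0}"]) auto
    then show ?thesis using True by simp
  next
    case False
    with x have x: "0 < x" by simp
    have "\<forall>\<^sub>F n in sequentially. \<mu> n < 1" using \<gamma> unfolding \<mu>_def by real_asymp
    then have ev: "\<forall>\<^sub>F n in sequentially. 0 \<le> \<mu> n \<and> \<mu> n < 1"
      using x by (auto simp: \<mu>_def)
    have lim: "(\<lambda>n. discrete_ml \<gamma> (\<mu> n) 1 n) \<longlonglongrightarrow> mittag_leffler \<gamma> 1 (- x)"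
      unfolding \<mu>_def by (rule discrete_ml_tendsto[OF \<gamma> x])
    have "(\<lambda>n. 1 / (1 + x * (rising_coeff (\<gamma> + 1) n / real (Suc n) powr \<gamma>)))
        \<longlonglongrightarrow> 1 / (1 + x * rGamma (\<gamma> + 1))"
      using G x by (intro tendsto_intros rising_coeff_asymptotic)
        (auto simp: rGamma_inverse_Gamma add.commute add_pos_pos less_imp_neq[symmetric])
    moreover have "x * (rising_coeff (\<gamma> + 1) n / real (Suc n) powr \<gamma>) = \<mu> n * rising_coeff (\<gamma> + 1) n" for n
      by (simp add: \<mu>_def)
    ultimately have up: "(\<lambda>n. 1 / (1 + \<mu> n * rising_coeff (\<gamma> + 1) n)) \<longlonglongrightarrow> 1 / (1 + x * rGamma (\<gamma> + 1))"
      by simp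
    have "(\<lambda>n. 1 / (1 + x / (rising_coeff (- \<gamma> + 1) n / real (Suc n) powr (- \<gamma>))))
        \<longlonglongrightarrow> 1 / (1 + x / rGamma (- \<gamma> + 1))"
      using G x by (intro tendsto_intros rising_coeff_asymptotic)
        (auto simp: rGamma_inverse_Gamma add_pos_pos less_imp_neq[symmetric])
    moreover have "x / (rising_coeff (- \<gamma> + 1) n / real (Suc n) powr (- \<gamma>)) = \<mu> n / rising_coeff (1 - \<gamma>) n" for n
      by (simp add: \<mu>_def powr_minus field_simps)
    ultimately have low: "(\<lambda>n. 1 / (1 + \<mu> n / rising_coeff (1 - \<gamma>) n)) \<longlonglongrightarrow> 1 / (1 + x / rGamma (- \<gamma> + 1))"
      by (simp only:)
    have "1 / (1 + x / rGamma (- \<gamma> + 1)) \<le> mittag_leffler \<gamma> 1 (- x)"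
      using ev by (intro tendsto_le[OF sequentially_bot lim low])
        (auto elim!: eventually_mono intro!: discrete_ml_1_ge \<gamma>)
    moreover have "mittag_leffler \<gamma> 1 (- x) \<le> 1 / (1 + x * rGamma (\<gamma> + 1))"
      using ev by (intro tendsto_le[OF sequentially_bot up lim])
        (auto elim!: eventually_mono intro!: discrete_ml_1_le \<gamma>)
    ultimately show ?thesis
      by (simp add: rGamma_inverse_Gamma add.commute divide_inverse)
  qed
  then show "1 / (1 + x * Gamma (1 - \<gamma>)) \<le> mittag_leffler \<gamma> 1 (- x)"
    and "mittag_leffler \<gamma> 1 (- x) \<le> 1 / (1 + x / Gamma (1 + \<gamma>))" by auto
qed

subsection \<open>The Plancherel inequality\<close>

lemma lborel_prod_integral:
  fixes f :: "'a::euclidean_space \<Rightarrow> real \<Rightarrow> 'b::{real_normed_field,banach,second_countable_topology}"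
  assumes "\<And>b. b \<in> Basis \<Longrightarrow> integrable lborel (f b)"
  shows "integrable lborel (\<lambda>x. \<Prod>b\<in>Basis. f b (x \<bullet> b))" (is ?int)
    and "(LINT x|lborel. (\<Prod>b\<in>Basis. f b (x \<bullet> b))) = (\<Prod>b\<in>Basis. LINT s|lborel. f b s)" (is ?eq)
proof -
  interpret product_sigma_finite "\<lambda>_::'a. lborel :: real measure" ..
  have [measurable]: "f b \<in> borel_measurable borel" if "b \<in> Basis" for b
    using borel_measurable_integrable[OF assms[OF that]] by simp
  have coord: "(\<Prod>b\<in>Basis. f b ((\<Sum>c\<in>Basis. x c *\<^sub>R c) \<bullet> b)) = (\<Prod>b\<in>Basis. f b (x b))" for x
    by (intro prod.cong refl) (simp add: inner_sum_left inner_Basis if_distrib cong: if_cong)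
  show ?int
    unfolding lborel_eq[where 'a='a]
    by (subst integrable_distr_eq) (auto simp: coord intro!: product_integrable_prod assms)
  show ?eq
    unfolding lborel_eq[where 'a='a]
    by (subst integral_distr) (auto simp: coord intro!: product_integral_prod assms)
qed

text \<open>The characteristic function of the standard normal distribution, rescaled by
  \<open>y = \<epsilon> s\<close>.\<close>

lemma gaussian_fourier_real:
  fixes \<epsilon> w :: real
  assumes \<epsilon>: "0 < \<epsilon>"
  shows "integrable lborel (\<lambda>s. of_real (exp (- (\<epsilon> * s)\<^sup>2 / 2)) * exp (\<i> * of_real (w * s)))"
    and "(LINT s|lborel. of_real (exp (- (\<epsilon> * s)\<^sup>2 / 2)) * exp (\<i> * of_real (w * s))) =
      complex_of_real (2 * pi * normal_density 0 \<epsilon> w)"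
proof -
  define h where "h y = complex_of_real (exp (- y\<^sup>2 / 2)) * exp (\<i> * of_real (w / \<epsilon> * y))" for y
  have h_eq: "h y = of_real (sqrt (2 * pi)) * (std_normal_density y *\<^sub>R iexp (w / \<epsilon> * y))" for y
    by (simp add: h_def std_normal_density_def scaleR_conv_of_real)
  have "integrable lborel (\<lambda>y. std_normal_density y *\<^sub>R iexp (w / \<epsilon> * y))"
  proof (rule Bochner_Integration.integrable_bound)
    show "integrable lborel std_normal_density" by simp
  qed (auto simp: norm_exp_i_times normal_density_nonneg)
  then have int: "integrable lborel h"
    unfolding h_eq[abs_def] by (rule integrable_mult_right)
  have "(LINT y|lborel. h y) = of_real (sqrt (2 * pi)) * (LINT y|lborel. std_normal_density y *\<^sub>R iexp (w / \<epsilon> * y))"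
    unfolding h_eq[abs_def] by (rule integral_mult_right_zero)
  also have "(LINT y|lborel. std_normal_density y *\<^sub>R iexp (w / \<epsilon> * y)) = char std_normal_distribution (w / \<epsilon>)"
    unfolding char_def by (subst integral_density) (auto simp: normal_density_nonneg)
  also have "\<dots> = of_real (exp (- (w / \<epsilon>)\<^sup>2 / 2))"
    by (simp add: char_std_normal_distribution)
  finally have val: "(LINT y|lborel. h y) = of_real (sqrt (2 * pi) * exp (- (w / \<epsilon>)\<^sup>2 / 2))" by simp
  have h_scale: "h (0 + \<epsilon> * s) = of_real (exp (- (\<epsilon> * s)\<^sup>2 / 2)) * exp (\<i> * of_real (w * s))" for s
    using \<epsilon> by (simp add: h_def)
  show "integrable lborel (\<lambda>s. of_real (exp (- (\<epsilon> * s)\<^sup>2 / 2)) * exp (\<i> * of_real (w * s)))"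
    using lborel_integrable_real_affine[OF int, of \<epsilon> 0] \<epsilon> unfolding h_scale by simp
  have "(LINT y|lborel. h y) = \<bar>\<epsilon>\<bar> *\<^sub>R (LINT s|lborel. h (0 + \<epsilon> * s))"
    using \<epsilon> by (intro lborel_integral_real_affine) simp
  with val have "of_real \<epsilon> * (LINT s|lborel. h (0 + \<epsilon> * s)) =
      complex_of_real (sqrt (2 * pi) * exp (- (w / \<epsilon>)\<^sup>2 / 2))"
    using \<epsilon> by (simp add: scaleR_conv_of_real)
  then have "(LINT s|lborel. h (0 + \<epsilon> * s)) =
      complex_of_real (sqrt (2 * pi) * exp (- (w / \<epsilon>)\<^sup>2 / 2) / \<epsilon>)"
    using \<epsilon> by (simp add: field_simps)
  also have "sqrt (2 * pi) * exp (- (w / \<epsilon>)\<^sup>2 / 2) / \<epsilon> = 2 * pi * normal_density 0 \<epsilon> w"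
  proof -
    have "2 * pi = sqrt (2 * pi) * sqrt (2 * pi)" by simp
    moreover have "sqrt (2 * pi * \<epsilon>\<^sup>2) = sqrt (2 * pi) * \<epsilon>" using \<epsilon> by (simp add: real_sqrt_mult)
    moreover have "(w / \<epsilon>)\<^sup>2 / 2 = w\<^sup>2 / (2 * \<epsilon>\<^sup>2)" by (simp add: power_divide)
    ultimately show ?thesis
      using \<epsilon> unfolding normal_density_def by (simp add: field_simps)
  qed
  finally show "(LINT s|lborel. of_real (exp (- (\<epsilon> * s)\<^sup>2 / 2)) * exp (\<i> * of_real (w * s))) =
      complex_of_real (2 * pi * normal_density 0 \<epsilon> w)"
    unfolding h_scale .
qed

text \<open>A factor of at most 1 that makes the integral over \<open>x\<close>, \<open>y\<close>
  and the frequency in \<open>fourier_integral_gaussian_le\<close> absolutely convergent and tends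
  to 1 with \<open>\<epsilon>\<close> tending to 0.\<close>

definition gaussian_cutoff :: "real \<Rightarrow> 'a::euclidean_space \<Rightarrow> real" where
  "gaussian_cutoff \<epsilon> \<xi> = exp (- (\<epsilon> * norm \<xi>)\<^sup>2 / 2)"

text \<open>The density of the centred normal distribution with covariance \<open>\<epsilon>\<close>
  squared times the identity; up to a power of \<open>2 * pi\<close> it is the Fourier transform of
  \<open>gaussian_cutoff \<epsilon>\<close>.\<close>

definition gaussian_kernel :: "real \<Rightarrow> 'a::euclidean_space \<Rightarrow> real" where
  "gaussian_kernel \<epsilon> z = (\<Prod>b\<in>Basis. normal_density 0 \<epsilon> (z \<bullet> b))"

lemma measurable_gaussian [measurable]:
  "gaussian_cutoff \<epsilon> \<in> borel_measurable borel" "gaussian_kernel \<epsilon> \<in> borel_measurable borel"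
  unfolding gaussian_cutoff_def[abs_def] gaussian_kernel_def[abs_def] by measurable

text \<open>Cutoff and phase both factor over the coordinates, which reduces the claim to the
  line.\<close>

lemma gaussian_cutoff_fourier:
  fixes z :: "'a::euclidean_space"
  assumes "0 < \<epsilon>"
  shows "integrable lborel (\<lambda>\<xi>. of_real (gaussian_cutoff \<epsilon> \<xi>) * exp (\<i> * of_real (z \<bullet> \<xi>)))" (is ?int)
    and "(LINT \<xi>|lborel. of_real (gaussian_cutoff \<epsilon> \<xi>) * exp (\<i> * of_real (z \<bullet> \<xi>))) =
      complex_of_real ((2 * pi) ^ DIM('a) * gaussian_kernel \<epsilon> z)" (is ?eq)
proof -
  have "(norm \<xi>)\<^sup>2 = (\<Sum>b\<in>Basis. (\<xi> \<bullet> b)\<^sup>2)" for \<xi> :: 'a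
    unfolding power2_norm_eq_inner by (subst euclidean_inner) (simp add: power2_eq_square)
  then have cutoff: "complex_of_real (gaussian_cutoff \<epsilon> \<xi>) = (\<Prod>b\<in>Basis. of_real (exp (- (\<epsilon> * (\<xi> \<bullet> b))\<^sup>2 / 2)))"
    for \<xi> :: 'a
    unfolding of_real_prod[symmetric] exp_sum[OF finite_Basis, symmetric]
    by (simp add: gaussian_cutoff_def power_mult_distrib sum_distrib_left sum_divide_distrib sum_negf)
  have phase: "exp (\<i> * of_real (z \<bullet> \<xi>)) = (\<Prod>b\<in>Basis. exp (\<i> * of_real ((z \<bullet> b) * (\<xi> \<bullet> b))))" for \<xi> :: 'a
    unfolding exp_sum[OF finite_Basis, symmetric]
    by (subst euclidean_inner) (simp add: sum_distrib_left)
  have eq: "of_real (gaussian_cutoff \<epsilon> \<xi>) * exp (\<i> * of_real (z \<bullet> \<xi>)) =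
      (\<Prod>b\<in>Basis. of_real (exp (- (\<epsilon> * (\<xi> \<bullet> b))\<^sup>2 / 2)) * exp (\<i> * of_real ((z \<bullet> b) * (\<xi> \<bullet> b))))" for \<xi> :: 'a
    unfolding cutoff phase prod.distrib ..
  show ?int
    unfolding eq by (rule lborel_prod_integral) (rule gaussian_fourier_real[OF assms])
  show ?eq
    unfolding eq
    by (subst lborel_prod_integral) (simp_all only: gaussian_fourier_real[OF assms], simp add: gaussian_kernel_def prod.distrib)
qed

lemma gaussian_kernel_nonneg: "0 \<le> gaussian_kernel \<epsilon> z"
  by (auto simp: gaussian_kernel_def intro!: prod_nonneg)

lemma gaussian_kernel_minus: "gaussian_kernel \<epsilon> (- z) = gaussian_kernel \<epsilon> z"
  by (simp add: gaussian_kernel_def normal_density_def)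

lemma gaussian_kernel_nn_integral:
  fixes x :: "'a::euclidean_space"
  assumes "0 < \<epsilon>"
  shows "(\<integral>\<^sup>+ y. ennreal (gaussian_kernel \<epsilon> (x - y)) \<partial>lborel) = 1"
    and "(\<integral>\<^sup>+ y. ennreal (gaussian_kernel \<epsilon> (y - x)) \<partial>lborel) = 1"
proof -
  have "(\<integral>\<^sup>+ s. ennreal (normal_density 0 \<epsilon> s) \<partial>lborel) = 1"
    using assms by (subst nn_integral_eq_integral) (auto simp: normal_density_nonneg)
  then have "(\<integral>\<^sup>+ z. ennreal (gaussian_kernel \<epsilon> z) \<partial>(lborel :: 'a measure)) = 1"
    unfolding gaussian_kernel_def
    using nn_integral_lborel_prod[where f = "\<lambda>(_::'a) s. ennreal (normal_density 0 \<epsilon> s)"]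
    by (subst prod_ennreal[symmetric]) auto
  then have "(\<integral>\<^sup>+ z. ennreal (gaussian_kernel \<epsilon> z) \<partial>(distr lborel borel ((+) (- x)))) = 1"
    unfolding lborel_distr_plus .
  then show *: "(\<integral>\<^sup>+ y. ennreal (gaussian_kernel \<epsilon> (y - x)) \<partial>lborel) = 1"
    by (subst (asm) nn_integral_distr) (auto simp: algebra_simps)
  then show "(\<integral>\<^sup>+ y. ennreal (gaussian_kernel \<epsilon> (x - y)) \<partial>lborel) = 1"
    by (subst gaussian_kernel_minus[symmetric]) simp
qed

section \<open>Plancherel's inequality for integrable functions\<close>

lemma integrable_tensor:
  fixes f g :: "_ \<Rightarrow> complex"
  assumes f: "integrable M f" and g: "integrable N g" and "sigma_finite_measure M" "sigma_finite_measure N"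
  shows "integrable (M \<Otimes>\<^sub>M N) (\<lambda>(x, y). f x * g y)"
    and "(LINT p|(M \<Otimes>\<^sub>M N). f (fst p) * g (snd p)) = (LINT x|M. f x) * (LINT y|N. g y)"
proof -
  interpret pair_sigma_finite M N using assms by (simp add: pair_sigma_finite_def)
  note [measurable] = borel_measurable_integrable[OF f] borel_measurable_integrable[OF g]
  show *: "integrable (M \<Otimes>\<^sub>M N) (\<lambda>(x, y). f x * g y)"
  proof (rule Fubini_integrable)
    show "integrable M (\<lambda>x. LINT y|N. norm (case (x, y) of (x, y) \<Rightarrow> f x * g y))"
      using f by (simp add: norm_mult)
    show "AE x in M. integrable N (\<lambda>y. case (x, y) of (x, y) \<Rightarrow> f x * g y)"
      using g by simp
  qed measurable
  show "(LINT p|(M \<Otimes>\<^sub>M N). f (fst p) * g (snd p)) = (LINT x|M. f x) * (LINT y|N. g y)"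
    using integral_fst'[OF *] by (simp add: case_prod_unfold)
qed

text \<open>The squared norm with values in \<open>ennreal\<close>: a measurable function that is
  not square-integrable has energy infinity, whereas \<open>L2_norm\<close> would give 0. Estimates
  of it therefore also prove membership in \<open>L2_space\<close>.\<close>

definition L2_energy :: "('a::euclidean_space \<Rightarrow> complex) \<Rightarrow> ennreal" where
  "L2_energy f = (\<integral>\<^sup>+ x. ennreal ((norm (f x))\<^sup>2) \<partial>lborel)"

lemma measurable_fourier_integral [measurable]:
  fixes f :: "real ^ 'n \<Rightarrow> complex"
  assumes [measurable]: "f \<in> borel_measurable borel"
  shows "fourier_integral f \<in> borel_measurable borel"
proof -
  have "(\<lambda>\<xi>. LINT x|lborel. f x * exp (- \<i> * of_real (x \<bullet> \<xi>))) \<in> borel_measurable borel"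
    by (rule lborel.borel_measurable_lebesgue_integral) measurable
  then show ?thesis
    unfolding fourier_integral_def[abs_def] by measurable
qed

text \<open>Schur's test: the product is split by
  \<open>2 |f(x) f(y)| \<le> |f(x)|^2 + |f(y)|^2\<close>, and the kernel integrates to 1 in each
  variable.\<close>

lemma gaussian_autocorrelation_le:
  fixes f :: "'a::euclidean_space \<Rightarrow> complex"
  assumes \<epsilon>: "0 < \<epsilon>" and [measurable]: "f \<in> borel_measurable borel"
  shows "(\<integral>\<^sup>+ p. ennreal (norm (f (fst p)) * norm (f (snd p)) * gaussian_kernel \<epsilon> (fst p - snd p))
      \<partial>(lborel \<Otimes>\<^sub>M lborel)) \<le> L2_energy f"
proof -
  let ?G = "\<lambda>x y. ennreal (gaussian_kernel \<epsilon> (x - y))" and ?h = "ennreal (1 / 2)"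
  have am_gm: "ennreal (norm (f x) * norm (f y) * gaussian_kernel \<epsilon> (x - y))
      \<le> ?h * (ennreal ((norm (f x))\<^sup>2) * ?G x y) + ?h * (ennreal ((norm (f y))\<^sup>2) * ?G x y)" for x y
  proof -
    have "2 * (norm (f x) * norm (f y)) \<le> (norm (f x))\<^sup>2 + (norm (f y))\<^sup>2"
      using sum_squares_bound[of "norm (f x)" "norm (f y)"] by simp
    then have "norm (f x) * norm (f y) * gaussian_kernel \<epsilon> (x - y)
        \<le> ((norm (f x))\<^sup>2 / 2 + (norm (f y))\<^sup>2 / 2) * gaussian_kernel \<epsilon> (x - y)"
      by (intro mult_right_mono gaussian_kernel_nonneg) simp
    then have "ennreal (norm (f x) * norm (f y) * gaussian_kernel \<epsilon> (x - y))
        \<le> ennreal (1 / 2 * ((norm (f x))\<^sup>2 * gaussian_kernel \<epsilon> (x - y))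
            + 1 / 2 * ((norm (f y))\<^sup>2 * gaussian_kernel \<epsilon> (x - y)))"
      by (intro ennreal_leI) (simp add: algebra_simps)
    also have "\<dots> = ?h * (ennreal ((norm (f x))\<^sup>2) * ?G x y) + ?h * (ennreal ((norm (f y))\<^sup>2) * ?G x y)"
      by (simp only: gaussian_kernel_nonneg zero_le_power2 mult_nonneg_nonneg zero_le_divide_1_iff
          zero_le_numeral ennreal_plus ennreal_mult)
    finally show ?thesis .
  qed
  have 1: "(\<integral>\<^sup>+ x. \<integral>\<^sup>+ y. ?h * (ennreal ((norm (f x))\<^sup>2) * ?G x y) \<partial>lborel \<partial>lborel) = ?h * L2_energy f"
    by (simp add: nn_integral_cmult gaussian_kernel_nn_integral[OF \<epsilon>] L2_energy_def)
  have "(\<integral>\<^sup>+ x. \<integral>\<^sup>+ y. ?h * (ennreal ((norm (f y))\<^sup>2) * ?G x y) \<partial>lborel \<partial>lborel)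
      = (\<integral>\<^sup>+ y. \<integral>\<^sup>+ x. ?h * (ennreal ((norm (f y))\<^sup>2) * ?G x y) \<partial>lborel \<partial>lborel)"
    by (rule lborel_pair.Fubini') measurable
  also have "\<dots> = ?h * L2_energy f"
    by (simp add: nn_integral_cmult gaussian_kernel_nn_integral[OF \<epsilon>] L2_energy_def)
  finally have 2: "(\<integral>\<^sup>+ x. \<integral>\<^sup>+ y. ?h * (ennreal ((norm (f y))\<^sup>2) * ?G x y) \<partial>lborel \<partial>lborel) = ?h * L2_energy f" .
  have "(\<integral>\<^sup>+ p. ennreal (norm (f (fst p)) * norm (f (snd p)) * gaussian_kernel \<epsilon> (fst p - snd p))
        \<partial>(lborel \<Otimes>\<^sub>M lborel))
      = (\<integral>\<^sup>+ x. \<integral>\<^sup>+ y. ennreal (norm (f x) * norm (f y) * gaussian_kernel \<epsilon> (x - y)) \<partial>lborel \<partial>lborel)"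
    by (subst lborel.nn_integral_fst[symmetric]) simp_all
  also have "\<dots> \<le> (\<integral>\<^sup>+ x. \<integral>\<^sup>+ y. ?h * (ennreal ((norm (f x))\<^sup>2) * ?G x y)
      + ?h * (ennreal ((norm (f y))\<^sup>2) * ?G x y) \<partial>lborel \<partial>lborel)"
    by (intro nn_integral_mono am_gm)
  also have "\<dots> = ?h * L2_energy f + ?h * L2_energy f"
    by (subst 1[symmetric], subst 2[symmetric]) (simp add: nn_integral_add)
  also have "\<dots> = (?h + ?h) * L2_energy f"
    by (rule distrib_right[symmetric])
  also have "?h + ?h = 1"
    by (subst ennreal_plus[symmetric]) simp_all
  finally show ?thesis by simp
qed

text \<open>The squared modulus is a double integral over \<open>x\<close> and \<open>y\<close>;
  integrating over the frequency first turns cutoff and phase into a multiple of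
  \<open>gaussian_kernel \<epsilon> (x - y)\<close>, to which the preceding estimate
  applies.\<close>

lemma fourier_integral_gaussian_le:
  fixes f :: "real ^ 'n \<Rightarrow> complex"
  assumes \<epsilon>: "0 < \<epsilon>" and f: "integrable lborel f"
  shows "(\<integral>\<^sup>+ \<xi>. ennreal (gaussian_cutoff \<epsilon> \<xi> * (norm (fourier_integral f \<xi>))\<^sup>2) \<partial>lborel) \<le> L2_energy f"
proof -
  have [measurable]: "f \<in> borel_measurable borel"
    using borel_measurable_integrable[OF f] by simp
  define \<phi> where "\<phi> \<xi> = (LINT x|lborel. f x * exp (- \<i> * of_real (x \<bullet> \<xi>)))" for \<xi>
  define F where "F = (\<lambda>(p, \<xi>). f (fst p) * cnj (f (snd p)) *
      (of_real (gaussian_cutoff \<epsilon> \<xi>) * exp (\<i> * of_real ((snd p - fst p) \<bullet> \<xi>))))"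
  let ?c = "(2 * pi) powr (- real CARD('n) / 2)"
  let ?N = "(2 * pi) ^ CARD('n)"
  have sf: "sigma_finite_measure (lborel \<Otimes>\<^sub>M lborel :: ((real ^ 'n) \<times> (real ^ 'n)) measure)"
    by (simp add: lborel_prod sigma_finite_lborel)
  interpret LLL: pair_sigma_finite "lborel \<Otimes>\<^sub>M lborel :: ((real ^ 'n) \<times> (real ^ 'n)) measure" "lborel :: (real ^ 'n) measure"
    using sf sigma_finite_lborel by (rule pair_sigma_finite.intro)
  have cf: "integrable lborel (\<lambda>y. cnj (f y))" using f by simp
  note tensor = integrable_tensor[OF _ _ sigma_finite_lborel sigma_finite_lborel]
  \<comment> \<open>Majorant for \<open>F\<close>: the phase has modulus 1, and the remaining
    factors separate.\<close>
  have int_abs: "integrable ((lborel \<Otimes>\<^sub>M lborel) \<Otimes>\<^sub>M lborel)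
      (\<lambda>(p, \<xi> :: real ^ 'n). (f (fst p) * cnj (f (snd p))) * complex_of_real (gaussian_cutoff \<epsilon> \<xi>))"
  proof -
    have "integrable (lborel \<Otimes>\<^sub>M lborel) (\<lambda>p. f (fst p) * cnj (f (snd p)))"
      using tensor(1)[OF f cf] by (simp add: case_prod_unfold)
    moreover have "integrable lborel (\<lambda>\<xi>::real^'n. complex_of_real (gaussian_cutoff \<epsilon> \<xi>))"
      using gaussian_cutoff_fourier(1)[OF \<epsilon>, of "0 :: real ^ 'n"] by simp
    ultimately show ?thesis
      by (rule integrable_tensor(1)) (rule sf sigma_finite_lborel)+
  qed
  have "F \<in> borel_measurable ((lborel \<Otimes>\<^sub>M lborel) \<Otimes>\<^sub>M lborel)"
  proof -
    have [measurable]: "cnj \<in> borel_measurable borel"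
      by (intro borel_measurable_continuous_onI continuous_intros)
    show ?thesis unfolding F_def by measurable
  qed
  then have int_F: "integrable ((lborel \<Otimes>\<^sub>M lborel) \<Otimes>\<^sub>M lborel) F"
    by (rule Bochner_Integration.integrable_bound[OF int_abs])
      (auto simp: F_def case_prod_unfold norm_mult norm_exp_i_times)
  have inner_xy: "(LINT p|(lborel \<Otimes>\<^sub>M lborel). F (p, \<xi>)) = of_real (gaussian_cutoff \<epsilon> \<xi> * (norm (\<phi> \<xi>))\<^sup>2)" for \<xi>
  proof -
    have i: "integrable lborel (\<lambda>x. f x * exp (- \<i> * of_real (x \<bullet> \<xi>)))"
      by (rule Bochner_Integration.integrable_bound[OF f]) (auto simp: norm_mult)
    have "(LINT p|(lborel \<Otimes>\<^sub>M lborel). F (p, \<xi>)) = (LINT p|(lborel \<Otimes>\<^sub>M lborel). of_real (gaussian_cutoff \<epsilon> \<xi>) *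
        ((f (fst p) * exp (- \<i> * of_real (fst p \<bullet> \<xi>))) * cnj (f (snd p) * exp (- \<i> * of_real (snd p \<bullet> \<xi>)))))"
      by (intro Bochner_Integration.integral_cong refl)
        (simp add: F_def exp_cnj inner_diff_left algebra_simps flip: exp_add)
    also have "\<dots> = of_real (gaussian_cutoff \<epsilon> \<xi>) * (\<phi> \<xi> * cnj (\<phi> \<xi>))"
      using tensor(2)[OF i integrable_cnj[OF i]] by (simp add: \<phi>_def del: complex_cnj_mult)
    finally show ?thesis
      by (simp only: complex_norm_square of_real_mult)
  qed
  have inner_\<xi>: "(LINT \<xi>|lborel. F (p, \<xi>)) =
      f (fst p) * cnj (f (snd p)) * of_real (?N * gaussian_kernel \<epsilon> (fst p - snd p))" for p
    unfolding F_def using gaussian_cutoff_fourier(2)[OF \<epsilon>, of "snd p - fst p"]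
      gaussian_kernel_minus[of \<epsilon> "snd p - fst p"]
    by simp
  have int_\<phi>: "integrable lborel (\<lambda>\<xi>. gaussian_cutoff \<epsilon> \<xi> * (norm (\<phi> \<xi>))\<^sup>2)"
  proof -
    have "integrable lborel (\<lambda>\<xi>. LINT p|(lborel \<Otimes>\<^sub>M lborel). F (p, \<xi>))"
      using LLL.integrable_snd[of "\<lambda>p \<xi>. F (p, \<xi>)"] int_F by simp
    then have "integrable lborel (\<lambda>\<xi>. Re (complex_of_real (gaussian_cutoff \<epsilon> \<xi> * (norm (\<phi> \<xi>))\<^sup>2)))"
      unfolding inner_xy by (rule integrable_Re)
    then show ?thesis by simp
  qed
  have "(LINT \<xi>|lborel. complex_of_real (gaussian_cutoff \<epsilon> \<xi> * (norm (\<phi> \<xi>))\<^sup>2)) =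
      (LINT p|(lborel \<Otimes>\<^sub>M lborel). f (fst p) * cnj (f (snd p)) * of_real (?N * gaussian_kernel \<epsilon> (fst p - snd p)))"
    using LLL.Fubini_integral[of "\<lambda>p \<xi>. F (p, \<xi>)"] int_F by (simp add: inner_xy inner_\<xi>)
  then have eq: "complex_of_real (LINT \<xi>|lborel. gaussian_cutoff \<epsilon> \<xi> * (norm (\<phi> \<xi>))\<^sup>2) =
      (LINT p|(lborel \<Otimes>\<^sub>M lborel). f (fst p) * cnj (f (snd p)) * of_real (?N * gaussian_kernel \<epsilon> (fst p - snd p)))"
    by (simp only: integral_complex_of_real)
  have "(LINT \<xi>|lborel. gaussian_cutoff \<epsilon> \<xi> * (norm (\<phi> \<xi>))\<^sup>2) \<ge> 0"
    by (simp add: gaussian_cutoff_def)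
  then have "ennreal (LINT \<xi>|lborel. gaussian_cutoff \<epsilon> \<xi> * (norm (\<phi> \<xi>))\<^sup>2) =
    ennreal (norm (complex_of_real (LINT \<xi>|lborel. gaussian_cutoff \<epsilon> \<xi> * (norm (\<phi> \<xi>))\<^sup>2)))"
    by simp
  also have "\<dots> \<le> (\<integral>\<^sup>+ p. ennreal (norm (f (fst p) * cnj (f (snd p)) * of_real (?N * gaussian_kernel \<epsilon> (fst p - snd p))))
      \<partial>(lborel \<Otimes>\<^sub>M lborel))"
    unfolding eq
  proof (rule integral_norm_bound_ennreal)
    show "integrable (lborel \<Otimes>\<^sub>M lborel)
        (\<lambda>p. f (fst p) * cnj (f (snd p)) * of_real (?N * gaussian_kernel \<epsilon> (fst p - snd p)))"
      using LLL.integrable_fst[of "\<lambda>p \<xi>. F (p, \<xi>)"] int_F by (simp only: inner_\<xi> case_prod_eta)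
  qed
  also have "\<dots> = (\<integral>\<^sup>+ p. ennreal ?N * ennreal (norm (f (fst p)) * norm (f (snd p)) * gaussian_kernel \<epsilon> (fst p - snd p))
      \<partial>(lborel \<Otimes>\<^sub>M lborel))"
    by (intro nn_integral_cong)
      (simp add: norm_mult norm_power abs_mult gaussian_kernel_nonneg mult_ac flip: ennreal_mult)
  also have "\<dots> \<le> ennreal ?N * L2_energy f"
    by (subst nn_integral_cmult) (auto intro!: mult_left_mono gaussian_autocorrelation_le \<epsilon>)
  finally have *: "(\<integral>\<^sup>+ \<xi>. ennreal (gaussian_cutoff \<epsilon> \<xi> * (norm (\<phi> \<xi>))\<^sup>2) \<partial>lborel) \<le> ennreal ?N * L2_energy f"
    using int_\<phi> by (subst nn_integral_eq_integral) (auto simp: gaussian_cutoff_def)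
  \<comment> \<open>The normalisation of \<open>fourier_integral\<close> cancels the power of
    \<open>2 * pi\<close> from the Gaussian integral.\<close>
  have c: "?c\<^sup>2 * ?N = 1"
  proof -
    have "?c\<^sup>2 = (2 * pi) powr (- real CARD('n))"
      unfolding power2_eq_square powr_add[symmetric] by simp
    moreover have "?N = (2 * pi) powr (real CARD('n))"
      by (rule powr_realpow[symmetric]) simp
    ultimately show ?thesis
      by (simp only: powr_add[symmetric]) simp
  qed
  have [measurable]: "\<phi> \<in> borel_measurable borel"
    unfolding \<phi>_def by (rule lborel.borel_measurable_lebesgue_integral) measurable
  have "(\<integral>\<^sup>+ \<xi>. ennreal (gaussian_cutoff \<epsilon> \<xi> * (norm (fourier_integral f \<xi>))\<^sup>2) \<partial>lborel) =
    (\<integral>\<^sup>+ \<xi>. ennreal (?c\<^sup>2) * ennreal (gaussian_cutoff \<epsilon> \<xi> * (norm (\<phi> \<xi>))\<^sup>2) \<partial>lborel)"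
    by (intro nn_integral_cong)
      (simp add: fourier_integral_def \<phi>_def norm_mult power_mult_distrib mult_ac gaussian_cutoff_def flip: ennreal_mult)
  also have "\<dots> = ennreal (?c\<^sup>2) * (\<integral>\<^sup>+ \<xi>. ennreal (gaussian_cutoff \<epsilon> \<xi> * (norm (\<phi> \<xi>))\<^sup>2) \<partial>lborel)"
    by (rule nn_integral_cmult) measurable
  also have "\<dots> \<le> ennreal (?c\<^sup>2) * (ennreal ?N * L2_energy f)"
    by (intro mult_left_mono *) simp
  also have "\<dots> = L2_energy f"
    using c by (simp add: mult.assoc[symmetric] flip: ennreal_mult)
  finally show ?thesis .
qed

text \<open>The cutoff is removed along \<open>\<epsilon> = 1 / (k + 1)\<close> by Fatou's lemma.
  The inequality serves twice: for the Cauchy property of truncated transforms and for stability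
  against data errors.\<close>

lemma plancherel_le:
  fixes f :: "real ^ 'n \<Rightarrow> complex"
  assumes f: "integrable lborel f"
  shows "L2_energy (fourier_integral f) \<le> L2_energy f"
proof -
  have [measurable]: "f \<in> borel_measurable borel"
    using borel_measurable_integrable[OF f] by simp
  define g where "g k \<xi> = ennreal (gaussian_cutoff (1 / real (Suc k)) \<xi> * (norm (fourier_integral f \<xi>))\<^sup>2)" for k \<xi>
  have [measurable]: "g k \<in> borel_measurable borel" for k
    unfolding g_def by measurable
  have "(\<lambda>k. g k \<xi>) \<longlonglongrightarrow> ennreal ((norm (fourier_integral f \<xi>))\<^sup>2)" for \<xi>
  proof -
    have "(\<lambda>k. (1 / real (Suc k))) \<longlonglongrightarrow> 0"
      using LIMSEQ_inverse_real_of_nat by (simp add: inverse_eq_divide)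
    then have "(\<lambda>k. gaussian_cutoff (1 / real (Suc k)) \<xi> * (norm (fourier_integral f \<xi>))\<^sup>2)
        \<longlonglongrightarrow> exp (- (0 * norm \<xi>)\<^sup>2 / 2) * (norm (fourier_integral f \<xi>))\<^sup>2"
      unfolding gaussian_cutoff_def by (intro tendsto_intros) auto
    then show ?thesis unfolding g_def by (intro tendsto_ennrealI) simp
  qed
  then have lim: "liminf (\<lambda>k. g k \<xi>) = ennreal ((norm (fourier_integral f \<xi>))\<^sup>2)" for \<xi>
    by (intro lim_imp_Liminf) auto
  have "L2_energy (fourier_integral f) = (\<integral>\<^sup>+ \<xi>. liminf (\<lambda>k. g k \<xi>) \<partial>lborel)"
    by (simp add: L2_energy_def lim)
  also have "\<dots> \<le> liminf (\<lambda>k. \<integral>\<^sup>+ \<xi>. g k \<xi> \<partial>lborel)"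
    by (rule nn_integral_liminf) simp
  also have "\<dots> \<le> L2_energy f"
    unfolding g_def by (intro Liminf_le always_eventually allI fourier_integral_gaussian_le f) simp_all
  finally show ?thesis .
qed

subsection \<open>Square-integrable functions\<close>

lemma L2_space_iff:
  fixes f :: "real ^ 'n \<Rightarrow> complex"
  shows "f \<in> L2_space \<longleftrightarrow> f \<in> borel_measurable borel \<and> L2_energy f < \<infinity>"
proof -
  have "integrable lborel (\<lambda>x. (norm (f x))\<^sup>2) \<longleftrightarrow> L2_energy f < \<infinity>"
    if [measurable]: "f \<in> borel_measurable borel"
    unfolding L2_energy_def by (subst integrable_iff_bounded) simp
  then show ?thesis by (auto simp: L2_space_def)
qed

lemma L2_space_measurable: "f \<in> L2_space \<Longrightarrow> f \<in> borel_measurable borel"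
  by (simp add: L2_space_iff)

lemma L2_norm_energy:
  assumes "f \<in> L2_space"
  shows "L2_energy f = ennreal ((L2_norm f)\<^sup>2)"
  using assms unfolding L2_energy_def L2_norm_def L2_space_def
  by (subst nn_integral_eq_integral) (auto simp: real_sqrt_pow2)

lemma L2_norm_nonneg: "0 \<le> L2_norm f"
  by (simp add: L2_norm_def)

lemma L2_norm_leI:
  assumes "f \<in> L2_space" "L2_energy f \<le> ennreal (c\<^sup>2)" "0 \<le> c"
  shows "L2_norm f \<le> c"
proof -
  have "(L2_norm f)\<^sup>2 \<le> c\<^sup>2"
    using assms by (simp add: L2_norm_energy)
  then show ?thesis using assms(3) by (rule power2_le_imp_le)
qed

lemma norm_add_squared_le:
  fixes a b :: "'a::real_normed_vector"
  shows "(norm (a + b))\<^sup>2 \<le> 2 * (norm a)\<^sup>2 + 2 * (norm b)\<^sup>2"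
proof -
  have "(norm (a + b))\<^sup>2 \<le> (norm a + norm b)\<^sup>2"
    by (intro power_mono norm_triangle_ineq) simp
  also have "\<dots> \<le> 2 * (norm a)\<^sup>2 + 2 * (norm b)\<^sup>2"
    using sum_squares_bound[of "norm a" "norm b"] by (simp add: power2_sum)
  finally show ?thesis .
qed

text \<open>A factor 2 takes the place of Minkowski's inequality: the pointwise bound integrates
  directly in \<open>ennreal\<close>, at the price of larger constants.\<close>

lemma L2_energy_add_le:
  fixes f g :: "'a::euclidean_space \<Rightarrow> complex"
  assumes [measurable]: "f \<in> borel_measurable borel" "g \<in> borel_measurable borel"
  shows "L2_energy (\<lambda>x. f x + g x) \<le> 2 * L2_energy f + 2 * L2_energy g"
proof -
  have "L2_energy (\<lambda>x. f x + g x) \<le>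
      (\<integral>\<^sup>+ x. 2 * ennreal ((norm (f x))\<^sup>2) + 2 * ennreal ((norm (g x))\<^sup>2) \<partial>lborel)"
    unfolding L2_energy_def
  proof (rule nn_integral_mono)
    fix x
    have "ennreal ((norm (f x + g x))\<^sup>2) \<le> ennreal (2 * (norm (f x))\<^sup>2 + 2 * (norm (g x))\<^sup>2)"
      by (intro ennreal_leI norm_add_squared_le)
    also have "\<dots> = 2 * ennreal ((norm (f x))\<^sup>2) + 2 * ennreal ((norm (g x))\<^sup>2)"
      by (simp add: ennreal_plus ennreal_mult)
    finally show "ennreal ((norm (f x + g x))\<^sup>2) \<le> 2 * ennreal ((norm (f x))\<^sup>2) + 2 * ennreal ((norm (g x))\<^sup>2)" .
  qed
  also have "\<dots> = 2 * L2_energy f + 2 * L2_energy g"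
    unfolding L2_energy_def by (simp add: nn_integral_add nn_integral_cmult)
  finally show ?thesis .
qed

lemma L2_energy_minus: "L2_energy (\<lambda>x. - f x) = L2_energy f"
  by (simp add: L2_energy_def)

lemma L2_energy_diff_le:
  fixes f g :: "'a::euclidean_space \<Rightarrow> complex"
  assumes "f \<in> borel_measurable borel" "g \<in> borel_measurable borel"
  shows "L2_energy (\<lambda>x. f x - g x) \<le> 2 * L2_energy f + 2 * L2_energy g"
  using L2_energy_add_le[of f "\<lambda>x. - g x"] assms by (simp add: L2_energy_minus)

lemma L2_space_diff:
  assumes "f \<in> L2_space" "g \<in> L2_space"
  shows "(\<lambda>x. f x - g x) \<in> L2_space"
proof -
  have "L2_energy (\<lambda>x. f x - g x) \<le> 2 * L2_energy f + 2 * L2_energy g"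
    using assms by (intro L2_energy_diff_le) (auto simp: L2_space_iff)
  also have "\<dots> < \<infinity>"
    using assms by (auto simp: L2_space_iff ennreal_mult_less_top)
  finally show ?thesis
    using assms by (auto simp: L2_space_iff)
qed

text \<open>Lower semicontinuity of the energy; the almost-everywhere and eventual forms fit limits
  along a chosen sequence of radii.\<close>

lemma L2_energy_Fatou:
  fixes f :: "'a::euclidean_space \<Rightarrow> complex"
  assumes [measurable]: "\<And>k. \<Phi> k \<in> borel_measurable borel"
    and lim: "AE x in lborel. (\<lambda>k. \<Phi> k x) \<longlonglongrightarrow> f x"
    and le: "\<forall>\<^sub>F k in sequentially. L2_energy (\<Phi> k) \<le> B"
  shows "L2_energy f \<le> B"
proof -
  have "L2_energy f = (\<integral>\<^sup>+ x. liminf (\<lambda>k. ennreal ((norm (\<Phi> k x))\<^sup>2)) \<partial>lborel)"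
    unfolding L2_energy_def using lim
  proof (intro nn_integral_cong_AE, eventually_elim)
    case (elim x)
    then have "(\<lambda>k. ennreal ((norm (\<Phi> k x))\<^sup>2)) \<longlonglongrightarrow> ennreal ((norm (f x))\<^sup>2)"
      by (intro tendsto_intros tendsto_ennrealI)
    then show ?case by (intro lim_imp_Liminf[symmetric]) auto
  qed
  also have "\<dots> \<le> liminf (\<lambda>k. L2_energy (\<Phi> k))"
    unfolding L2_energy_def by (rule nn_integral_liminf) simp
  also have "\<dots> \<le> B"
    using le by (intro Liminf_le) simp_all
  finally show ?thesis .
qed

text \<open>The Riesz-Fischer argument. The decay \<open>(1 / 4) ^ k\<close> absorbs a weight
  \<open>2 ^ k\<close>, so the weighted squares of the increments have a finite integral and hence a
  finite sum almost everywhere.\<close>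

lemma L2_fast_Cauchy_converges:
  fixes \<Phi> :: "nat \<Rightarrow> 'a::euclidean_space \<Rightarrow> complex"
  assumes [measurable]: "\<And>k. \<Phi> k \<in> borel_measurable borel"
    and fast: "\<And>k. L2_energy (\<lambda>x. \<Phi> (Suc k) x - \<Phi> k x) \<le> ennreal ((1 / 4) ^ k)"
  shows "AE x in lborel. convergent (\<lambda>k. \<Phi> k x)"
proof -
  define D where "D k x = norm (\<Phi> (Suc k) x - \<Phi> k x)" for k x
  have [measurable]: "D k \<in> borel_measurable borel" for k
    unfolding D_def by measurable
  have "(\<integral>\<^sup>+ x. (\<Sum>k. ennreal (2 ^ k * (D k x)\<^sup>2)) \<partial>lborel) = (\<Sum>k. ennreal (2 ^ k) * L2_energy (\<lambda>x. \<Phi> (Suc k) x - \<Phi> k x))"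
    by (subst nn_integral_suminf) (simp_all add: D_def L2_energy_def ennreal_mult nn_integral_cmult)
  also have "\<dots> \<le> (\<Sum>k. ennreal ((1 / 2) ^ k))"
  proof (rule suminf_le)
    fix k
    have "ennreal (2 ^ k) * L2_energy (\<lambda>x. \<Phi> (Suc k) x - \<Phi> k x) \<le> ennreal (2 ^ k) * ennreal ((1 / 4) ^ k)"
      by (intro mult_left_mono fast) simp
    also have "\<dots> = ennreal ((1 / 2) ^ k)"
      by (simp flip: ennreal_mult power_mult_distrib)
    finally show "ennreal (2 ^ k) * L2_energy (\<lambda>x. \<Phi> (Suc k) x - \<Phi> k x) \<le> ennreal ((1 / 2) ^ k)" .
  qed simp_all
  also have "\<dots> = ennreal 2"
    by (subst suminf_ennreal2) (simp_all add: suminf_geometric)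
  finally have "(\<integral>\<^sup>+ x. (\<Sum>k. ennreal (2 ^ k * (D k x)\<^sup>2)) \<partial>lborel) \<noteq> \<infinity>"
    by (auto simp: top_unique)
  then have "AE x in lborel. (\<Sum>k. ennreal (2 ^ k * (D k x)\<^sup>2)) \<noteq> \<infinity>"
    by (intro nn_integral_PInf_AE) simp_all
  then show ?thesis
  proof eventually_elim
    case (elim x)
    then have s: "summable (\<lambda>k. 2 ^ k * (D k x)\<^sup>2)"
      by (intro summable_suminf_not_top) (auto simp: infinity_ennreal_def)
    have "summable (\<lambda>k. norm (\<Phi> (Suc k) x - \<Phi> k x))"
    proof (rule summable_comparison_test')
      show "summable (\<lambda>k. 2 ^ k * (D k x)\<^sup>2 + (1 / 2) ^ k)"
        by (intro summable_add s summable_geometric) simp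
      fix k :: nat
      define a :: real where "a = 2 ^ k"
      have a: "0 < a" "(1 / 2) ^ k = 1 / a"
        by (simp_all add: a_def power_one_over)
      \<comment> \<open>Expanding this square trades weighted squares for first powers:
        \<open>2 D \<le> a D^2 + 1 / a\<close>.\<close>
      have "0 \<le> (a * D k x - 1)\<^sup>2 / a" using a by simp
      also have "\<dots> = a * (D k x)\<^sup>2 + 1 / a - 2 * D k x"
        using a by (simp add: power2_eq_square field_simps)
      finally have "2 * D k x \<le> 2 ^ k * (D k x)\<^sup>2 + (1 / 2) ^ k"
        unfolding a(2) by (simp add: a_def)
      moreover have "0 \<le> D k x" by (simp add: D_def)
      ultimately have "D k x \<le> 2 ^ k * (D k x)\<^sup>2 + (1 / 2) ^ k" by linarith
      then show "norm (norm (\<Phi> (Suc k) x - \<Phi> k x)) \<le> 2 ^ k * (D k x)\<^sup>2 + (1 / 2) ^ k"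
        by (simp add: D_def)
    qed
    then have "summable (\<lambda>k. \<Phi> (Suc k) x - \<Phi> k x)"
      by (rule summable_norm_cancel)
    then have "(\<lambda>n. \<Phi> 0 x + (\<Sum>k<n. \<Phi> (Suc k) x - \<Phi> k x)) \<longlonglongrightarrow> \<Phi> 0 x + (\<Sum>k. \<Phi> (Suc k) x - \<Phi> k x)"
      by (intro tendsto_intros summable_LIMSEQ)
    moreover have "\<Phi> 0 x + (\<Sum>k<n. \<Phi> (Suc k) x - \<Phi> k x) = \<Phi> n x" for n
      unfolding sum_lessThan_telescope[of "\<lambda>k. \<Phi> k x"] by simp
    ultimately show ?case
      by (auto simp: convergent_def)
  qed
qed

subsection \<open>The Fourier transform on square-integrable functions\<close>

definition truncation :: "real \<Rightarrow> (real ^ 'n \<Rightarrow> complex) \<Rightarrow> real ^ 'n \<Rightarrow> complex" where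
  "truncation R f x = indicator (cball 0 R) x * f x"

lemma measurable_truncation [measurable]:
  "f \<in> borel_measurable borel \<Longrightarrow> truncation R f \<in> borel_measurable borel"
proof -
  assume [measurable]: "f \<in> borel_measurable borel"
  have [measurable]: "cball 0 R \<in> sets borel" by simp
  show ?thesis unfolding truncation_def[abs_def] by measurable
qed

lemma integrable_truncation:
  fixes f :: "real ^ 'n \<Rightarrow> complex"
  assumes f: "f \<in> L2_space"
  shows "integrable lborel (truncation R f)"
proof (rule Bochner_Integration.integrable_bound)
  note [measurable] = L2_space_measurable[OF f]
  show "integrable lborel (\<lambda>x::real^'n. indicator (cball 0 R) x + (norm (f x))\<^sup>2)"
    using f emeasure_lborel_cball_finite[of "0 :: real ^ 'n" R]
    by (intro Bochner_Integration.integrable_add integrable_real_indicator) (auto simp: L2_space_def)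
  have "norm (truncation R f x) \<le> norm (indicator (cball 0 R) x + (norm (f x))\<^sup>2 :: real)" for x
  proof -
    \<comment> \<open>The ball has finite measure, so there the square dominates the first power up
      to an integrable constant.\<close>
    have "norm (f x) \<le> 1 + (norm (f x))\<^sup>2"
      using sum_squares_bound[of "norm (f x)" 1] norm_ge_zero[of "f x"] unfolding one_power2 by linarith
    then show ?thesis by (auto simp: truncation_def indicator_def)
  qed
  then show "AE x in lborel. norm (truncation R f x) \<le> norm (indicator (cball 0 R) x + (norm (f x))\<^sup>2 :: real)"
    by simp
qed (simp add: measurable_truncation L2_space_measurable f)

lemma fourier_integral_diff:
  assumes "integrable lborel f" "integrable lborel g"
  shows "fourier_integral (\<lambda>x. f x - g x) \<xi> = fourier_integral f \<xi> - fourier_integral g \<xi>"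
proof -
  have i: "integrable lborel (\<lambda>x. h x * exp (- \<i> * of_real (x \<bullet> \<xi>)))" if "integrable lborel h" for h
    using that by (rule Bochner_Integration.integrable_bound)
      (use borel_measurable_integrable[OF that] in \<open>auto simp: norm_mult\<close>)
  show ?thesis
    unfolding fourier_integral_def left_diff_distrib
    by (subst Bochner_Integration.integral_diff) (use i assms in \<open>auto simp: right_diff_distrib\<close>)
qed

lemma has_fourier_transform_iff:
  "has_fourier_transform f F \<longleftrightarrow> F \<in> L2_space \<and>
    ((\<lambda>R. L2_energy (\<lambda>\<xi>. fourier_integral (truncation R f) \<xi> - F \<xi>)) \<longlongrightarrow> 0) at_top"
  by (simp add: has_fourier_transform_def L2_energy_def truncation_def[abs_def])

definition tail_energy :: "real \<Rightarrow> (real ^ 'n \<Rightarrow> complex) \<Rightarrow> ennreal" where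
  "tail_energy R f = (\<integral>\<^sup>+ x. indicator (- cball 0 R) x * ennreal ((norm (f x))\<^sup>2) \<partial>lborel)"

lemma tail_energy_tendsto_0:
  fixes f :: "real ^ 'n \<Rightarrow> complex"
  assumes f: "f \<in> L2_space"
  shows "((\<lambda>R. tail_energy R f) \<longlongrightarrow> 0) at_top"
proof (rule tendsto_at_topI_sequentially)
  fix X :: "nat \<Rightarrow> real" assume X: "filterlim X at_top sequentially"
  note [measurable] = L2_space_measurable[OF f]
  have "(\<lambda>n. \<integral>\<^sup>+ x. indicator (- cball 0 (X n)) x * ennreal ((norm (f x))\<^sup>2) \<partial>lborel)
      \<longlonglongrightarrow> (\<integral>\<^sup>+ (x :: real ^ 'n). 0 \<partial>lborel)"
  proof (rule nn_integral_dominated_convergence[where w = "\<lambda>x. ennreal ((norm (f x))\<^sup>2)"])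
    show "(\<integral>\<^sup>+ x. ennreal ((norm (f x))\<^sup>2) \<partial>lborel) < \<infinity>"
      using f by (simp add: L2_space_iff L2_energy_def)
    show "AE x in lborel. (\<lambda>n. indicator (- cball 0 (X n)) x * ennreal ((norm (f x))\<^sup>2)) \<longlonglongrightarrow> 0"
    proof (rule AE_I2)
      fix x :: "real ^ 'n"
      have "\<forall>\<^sub>F n in sequentially. norm x \<le> X n"
        using X by (simp add: filterlim_at_top)
      then have "\<forall>\<^sub>F n in sequentially. indicator (- cball 0 (X n)) x * ennreal ((norm (f x))\<^sup>2) = 0"
        by eventually_elim simp
      then show "(\<lambda>n. indicator (- cball 0 (X n)) x * ennreal ((norm (f x))\<^sup>2)) \<longlonglongrightarrow> 0"
        by (rule tendsto_eventually)
    qed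
  qed (auto simp: indicator_def)
  then show "(\<lambda>n. tail_energy (X n) f) \<longlonglongrightarrow> 0"
    by (simp add: tail_energy_def)
qed

text \<open>Linearity and Plancherel's inequality reduce this to the truncations themselves, whose
  difference vanishes in the smaller ball and is dominated by \<open>f\<close> outside it.\<close>

lemma fourier_truncation_Cauchy:
  fixes f :: "real ^ 'n \<Rightarrow> complex"
  assumes f: "f \<in> L2_space"
  shows "L2_energy (\<lambda>\<xi>. fourier_integral (truncation R f) \<xi> - fourier_integral (truncation S f) \<xi>)
      \<le> tail_energy (min R S) f"
proof -
  have "L2_energy (\<lambda>\<xi>. fourier_integral (truncation R f) \<xi> - fourier_integral (truncation S f) \<xi>)
      = L2_energy (fourier_integral (\<lambda>x. truncation R f x - truncation S f x))"
    by (simp add: fourier_integral_diff integrable_truncation f L2_energy_def)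
  also have "\<dots> \<le> L2_energy (\<lambda>x. truncation R f x - truncation S f x)"
    by (intro plancherel_le Bochner_Integration.integrable_diff integrable_truncation f)
  also have "\<dots> \<le> tail_energy (min R S) f"
    unfolding L2_energy_def tail_energy_def
    by (intro nn_integral_mono) (auto simp: truncation_def indicator_def min_def)
  finally show ?thesis .
qed

lemma fourier_truncation_energy_le:
  fixes f :: "real ^ 'n \<Rightarrow> complex"
  assumes f: "f \<in> L2_space"
  shows "L2_energy (fourier_integral (truncation R f)) \<le> L2_energy f"
proof -
  have "L2_energy (fourier_integral (truncation R f)) \<le> L2_energy (truncation R f)"
    by (intro plancherel_le integrable_truncation f)
  also have "\<dots> \<le> L2_energy f"
    unfolding L2_energy_def
    by (intro nn_integral_mono) (auto simp: truncation_def indicator_def)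
  finally show ?thesis .
qed

text \<open>Radii with fast decaying tails give an almost-everywhere limit \<open>F\<close>, and
  Fatou's lemma turns the Cauchy estimate into convergence along all radii. The energy bound is
  recorded for this \<open>F\<close> and reaches \<open>fourier f\<close> by uniqueness.\<close>

lemma has_fourier_transform_exists:
  fixes f :: "real ^ 'n \<Rightarrow> complex"
  assumes f: "f \<in> L2_space"
  obtains F where "has_fourier_transform f F" "L2_energy F \<le> L2_energy f"
proof -
  note [measurable] = L2_space_measurable[OF f]
  let ?\<Phi> = "\<lambda>R. fourier_integral (truncation R f)"
  \<comment> \<open>\<open>r k \<ge> k\<close> makes the radii diverge, so that
    \<open>min R (r k)\<close> is eventually \<open>R\<close>.\<close>
  have "\<exists>r \<ge> real k. tail_energy r f \<le> ennreal ((1 / 4) ^ k)" for k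
  proof -
    have "\<forall>\<^sub>F R in at_top. tail_energy R f < ennreal ((1 / 4) ^ k)"
      using order_tendstoD(2)[OF tail_energy_tendsto_0[OF f]] by simp
    then obtain R0 where "\<And>R. R0 \<le> R \<Longrightarrow> tail_energy R f < ennreal ((1 / 4) ^ k)"
      by (auto simp: eventually_at_top_linorder)
    then show ?thesis
      by (intro exI[of _ "max (real k) R0"]) (simp add: less_imp_le)
  qed
  then obtain r where r: "\<And>k. real k \<le> r k" "\<And>k. tail_energy (r k) f \<le> ennreal ((1 / 4) ^ k)"
    by metis
  have fast: "L2_energy (\<lambda>\<xi>. ?\<Phi> (r (Suc k)) \<xi> - ?\<Phi> (r k) \<xi>) \<le> ennreal ((1 / 4) ^ k)" for k
  proof -
    have "tail_energy (r (Suc k)) f \<le> ennreal ((1 / 4) ^ k)"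
      by (rule order_trans[OF r(2)]) (auto intro!: ennreal_leI power_decreasing)
    then have "tail_energy (min (r (Suc k)) (r k)) f \<le> ennreal ((1 / 4) ^ k)"
      using r(2)[of k] by (simp add: min_def)
    then show ?thesis
      by (rule order_trans[OF fourier_truncation_Cauchy[OF f]])
  qed
  \<comment> \<open>Where the sequence diverges, \<open>lim\<close> has an unspecified value; these
    points form a null set, and \<open>F\<close> is measurable all the same.\<close>
  define F where "F \<xi> = lim (\<lambda>k. ?\<Phi> (r k) \<xi>)" for \<xi>
  have [measurable]: "F \<in> borel_measurable borel"
    unfolding F_def by (rule borel_measurable_lim_metric) measurable
  have conv: "AE \<xi> in lborel. (\<lambda>k. ?\<Phi> (r k) \<xi>) \<longlonglongrightarrow> F \<xi>"
    using L2_fast_Cauchy_converges[of "\<lambda>k. ?\<Phi> (r k)", OF _ fast]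
    by (auto simp: F_def convergent_LIMSEQ_iff)
  have F_le: "L2_energy F \<le> L2_energy f"
    by (rule L2_energy_Fatou[OF _ conv]) (auto intro!: always_eventually fourier_truncation_energy_le f)
  have "L2_energy (\<lambda>\<xi>. ?\<Phi> R \<xi> - F \<xi>) \<le> tail_energy R f" for R
  proof (rule L2_energy_Fatou)
    show "AE \<xi> in lborel. (\<lambda>k. ?\<Phi> R \<xi> - ?\<Phi> (r k) \<xi>) \<longlonglongrightarrow> ?\<Phi> R \<xi> - F \<xi>"
      using conv by eventually_elim (intro tendsto_intros)
    show "\<forall>\<^sub>F k in sequentially. L2_energy (\<lambda>\<xi>. ?\<Phi> R \<xi> - ?\<Phi> (r k) \<xi>) \<le> tail_energy R f"
      using eventually_ge_at_top[of "nat \<lceil>R\<rceil>"]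
    proof eventually_elim
      case (elim k)
      then have "R \<le> r k" using r(1)[of k] by linarith
      then show ?case
        using fourier_truncation_Cauchy[OF f, of R "r k"] by simp
    qed
  qed measurable
  then have "((\<lambda>R. L2_energy (\<lambda>\<xi>. ?\<Phi> R \<xi> - F \<xi>)) \<longlongrightarrow> 0) at_top"
    by (intro tendsto_sandwich[OF _ _ tendsto_const tail_energy_tendsto_0[OF f]]) auto
  moreover have "F \<in> L2_space"
    using f F_le by (auto simp: L2_space_iff)
  ultimately have "has_fourier_transform f F"
    by (simp add: has_fourier_transform_iff)
  then show ?thesis using F_le by (rule that)
qed

section \<open>Linearity and uniqueness of the transform\<close>

lemma has_fourier_transform_diff:
  fixes f g :: "real ^ 'n \<Rightarrow> complex"
  assumes "f \<in> L2_space" "g \<in> L2_space" "has_fourier_transform f F" "has_fourier_transform g G"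
  shows "has_fourier_transform (\<lambda>x. f x - g x) (\<lambda>\<xi>. F \<xi> - G \<xi>)"
proof -
  note [measurable] = L2_space_measurable[OF assms(1)] L2_space_measurable[OF assms(2)]
  have FG: "F \<in> L2_space" "G \<in> L2_space"
    using assms by (auto simp: has_fourier_transform_iff)
  note [measurable] = L2_space_measurable[OF FG(1)] L2_space_measurable[OF FG(2)]
  let ?e = "\<lambda>R f F. L2_energy (\<lambda>\<xi>. fourier_integral (truncation R f) \<xi> - F \<xi>)"
  have le: "?e R (\<lambda>x. f x - g x) (\<lambda>\<xi>. F \<xi> - G \<xi>) \<le> 2 * ?e R f F + 2 * ?e R g G" for R
  proof -
    have "truncation R (\<lambda>x. f x - g x) = (\<lambda>x. truncation R f x - truncation R g x)"
      by (auto simp: truncation_def right_diff_distrib)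
    then have "fourier_integral (truncation R (\<lambda>x. f x - g x)) \<xi> - (F \<xi> - G \<xi>) =
        (fourier_integral (truncation R f) \<xi> - F \<xi>) - (fourier_integral (truncation R g) \<xi> - G \<xi>)" for \<xi>
      using assms by (simp add: fourier_integral_diff integrable_truncation)
    then show ?thesis
      by (simp only:) (rule L2_energy_diff_le; measurable)
  qed
  have "((\<lambda>R. 2 * ?e R f F + 2 * ?e R g G) \<longlongrightarrow> 2 * 0 + 2 * 0) at_top"
    using assms by (intro tendsto_add ennreal_tendsto_cmult) (auto simp: has_fourier_transform_iff)
  then have lim: "((\<lambda>R. 2 * ?e R f F + 2 * ?e R g G) \<longlongrightarrow> 0) at_top"
    by (simp only: mult_zero_right add_0)
  have "((\<lambda>R. ?e R (\<lambda>x. f x - g x) (\<lambda>\<xi>. F \<xi> - G \<xi>)) \<longlongrightarrow> 0) at_top"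
    by (rule tendsto_sandwich[OF _ _ tendsto_const lim]) (intro always_eventually allI zero_le le)+
  then show ?thesis
    using L2_space_diff[OF FG] by (simp add: has_fourier_transform_iff)
qed

text \<open>The difference of two transforms of \<open>f\<close> is a transform of the zero
  function, whose truncated Fourier integrals vanish; its energy is thus a constant tending to
  0.\<close>

lemma has_fourier_transform_unique:
  fixes f :: "real ^ 'n \<Rightarrow> complex"
  assumes "f \<in> L2_space" "has_fourier_transform f F" "has_fourier_transform f G"
  shows "AE \<xi> in lborel. F \<xi> = G \<xi>"
proof -
  have FG: "F \<in> L2_space" "G \<in> L2_space"
    using assms by (auto simp: has_fourier_transform_iff)
  note [measurable] = L2_space_measurable[OF FG(1)] L2_space_measurable[OF FG(2)]
  have "has_fourier_transform (\<lambda>x. 0 :: complex) (\<lambda>\<xi>. F \<xi> - G \<xi>)"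
    using has_fourier_transform_diff[OF assms(1,1,2,3)] by simp
  moreover have "fourier_integral (truncation R (\<lambda>x. 0)) \<xi> = 0" for R and \<xi> :: "real ^ 'n"
    by (simp add: truncation_def fourier_integral_def)
  ultimately have "((\<lambda>R::real. L2_energy (\<lambda>\<xi>. F \<xi> - G \<xi>)) \<longlongrightarrow> 0) at_top"
    by (simp add: has_fourier_transform_iff L2_energy_def norm_minus_commute)
  then have "L2_energy (\<lambda>\<xi>. F \<xi> - G \<xi>) = 0"
    by (simp add: tendsto_const_iff)
  then have "AE \<xi> in lborel. ennreal ((norm (F \<xi> - G \<xi>))\<^sup>2) = 0"
    unfolding L2_energy_def by (subst (asm) nn_integral_0_iff_AE) auto
  then show ?thesis by eventually_elim simp
qed

lemma has_fourier_transform_fourier: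
  assumes "f \<in> L2_space"
  shows "has_fourier_transform f (fourier f)"
proof -
  obtain F where "has_fourier_transform f F"
    using has_fourier_transform_exists[OF assms] .
  then show ?thesis
    using someI[of "has_fourier_transform f" F] by (simp add: fourier_def)
qed

lemma fourier_in_L2: "f \<in> L2_space \<Longrightarrow> fourier f \<in> L2_space"
  using has_fourier_transform_fourier by (auto simp: has_fourier_transform_def)

lemma fourier_diff_AE:
  assumes "f \<in> L2_space" "g \<in> L2_space"
  shows "AE \<xi> in lborel. fourier (\<lambda>x. f x - g x) \<xi> = fourier f \<xi> - fourier g \<xi>"
  using L2_space_diff[OF assms]
  by (rule has_fourier_transform_unique)
    (intro has_fourier_transform_diff has_fourier_transform_fourier L2_space_diff assms)+

lemma L2_energy_cong_AE: "AE x in lborel. f x = g x \<Longrightarrow> L2_energy f = L2_energy g"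
  unfolding L2_energy_def by (intro nn_integral_cong_AE) auto

lemma L2_energy_fourier_le:
  assumes "f \<in> L2_space"
  shows "L2_energy (fourier f) \<le> L2_energy f"
proof -
  obtain F where F: "has_fourier_transform f F" "L2_energy F \<le> L2_energy f"
    using has_fourier_transform_exists[OF assms] .
  have "AE \<xi> in lborel. fourier f \<xi> = F \<xi>"
    by (intro has_fourier_transform_unique[OF assms] has_fourier_transform_fourier assms F)
  with F show ?thesis by (simp add: L2_energy_cong_AE)
qed

section \<open>Norm bounds from pointwise bounds\<close>

lemma L2_energy_scaled_norm:
  fixes f :: "'a::euclidean_space \<Rightarrow> complex"
  assumes [measurable]: "f \<in> borel_measurable borel"
  shows "L2_energy (\<lambda>x. of_real (a * norm (f x))) = ennreal (a\<^sup>2) * L2_energy f"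
  unfolding L2_energy_def
  by (subst nn_integral_cmult[symmetric]) (simp_all add: norm_mult power_mult_distrib ennreal_mult)

text \<open>Energies are added with the factor 2 from \<open>L2_energy_add_le\<close>, and
  \<open>2 A^2 + 2 B^2 \<le> (2 (A + B))^2\<close> for \<open>A, B \<ge> 0\<close> explains the 2 in
  the conclusion.\<close>

lemma L2_dominated_sum:
  fixes f g h :: "real ^ 'n \<Rightarrow> complex"
  assumes f: "f \<in> borel_measurable borel" and g: "g \<in> L2_space" and h: "h \<in> L2_space"
    and le: "AE x in lborel. norm (f x) \<le> a * norm (g x) + b * norm (h x)"
    and ab: "0 \<le> a" "0 \<le> b" and norms: "L2_norm g \<le> c" "L2_norm h \<le> d"
  shows "f \<in> L2_space" and "L2_norm f \<le> 2 * (a * c + b * d)"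
proof -
  note [measurable] = f L2_space_measurable[OF g] L2_space_measurable[OF h]
  have cd: "0 \<le> c" "0 \<le> d"
    using norms L2_norm_nonneg order_trans by blast+
  have "L2_energy f \<le> L2_energy (\<lambda>x. of_real (a * norm (g x)) + of_real (b * norm (h x)))"
    unfolding L2_energy_def using le
  proof (intro nn_integral_mono_AE, eventually_elim)
    case (elim x)
    then have "norm (f x) \<le> norm (complex_of_real (a * norm (g x)) + complex_of_real (b * norm (h x)))"
      unfolding of_real_add[symmetric] norm_of_real by linarith
    then show ?case by (intro ennreal_leI power_mono) auto
  qed
  also have "\<dots> \<le> 2 * (ennreal (a\<^sup>2) * L2_energy g) + 2 * (ennreal (b\<^sup>2) * L2_energy h)"
    by (subst (1 2) L2_energy_scaled_norm[symmetric], measurable) (rule L2_energy_add_le; measurable)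
  also have "\<dots> = ennreal (2 * (a * L2_norm g)\<^sup>2 + 2 * (b * L2_norm h)\<^sup>2)"
    using g h by (simp add: L2_norm_energy ennreal_plus ennreal_mult power_mult_distrib)
  also have "\<dots> \<le> ennreal ((2 * (a * c + b * d))\<^sup>2)"
  proof (rule ennreal_leI)
    have "(a * L2_norm g)\<^sup>2 \<le> (a * c)\<^sup>2" "(b * L2_norm h)\<^sup>2 \<le> (b * d)\<^sup>2"
      using ab norms L2_norm_nonneg by (auto intro!: power_mono mult_left_mono mult_nonneg_nonneg)
    moreover have "0 \<le> (a * c) * (b * d)" using ab cd by simp
    moreover have "(2 * (a * c + b * d))\<^sup>2 = 4 * (a * c)\<^sup>2 + 4 * (b * d)\<^sup>2 + 8 * ((a * c) * (b * d))"
      by (simp add: power2_eq_square algebra_simps)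
    ultimately show "2 * (a * L2_norm g)\<^sup>2 + 2 * (b * L2_norm h)\<^sup>2 \<le> (2 * (a * c + b * d))\<^sup>2"
      using zero_le_power2[of "a * c"] zero_le_power2[of "b * d"] by linarith
  qed
  finally have le: "L2_energy f \<le> ennreal ((2 * (a * c + b * d))\<^sup>2)" .
  then show "f \<in> L2_space"
    using f by (auto simp: L2_space_iff top_unique less_top[symmetric])
  then show "L2_norm f \<le> 2 * (a * c + b * d)"
    using le ab cd by (intro L2_norm_leI) auto
qed

lemma L2_norm_cong_AE:
  assumes "f \<in> L2_space" "g \<in> L2_space" "AE x in lborel. f x = g x"
  shows "L2_norm f = L2_norm g"
  using L2_energy_cong_AE[OF assms(3)] assms
  by (simp add: L2_norm_energy L2_norm_nonneg power2_eq_iff_nonneg)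

lemma L2_norm_fourier_le:
  assumes "f \<in> L2_space"
  shows "L2_norm (fourier f) \<le> L2_norm f"
  using assms fourier_in_L2[OF assms] L2_energy_fourier_le[OF assms]
  by (intro L2_norm_leI) (simp_all add: L2_norm_energy L2_norm_nonneg)

lemma measurable_sobolev_weighted:
  fixes f :: "real ^ 'n \<Rightarrow> complex"
  assumes "f \<in> L2_space"
  shows "sobolev_weighted l f \<in> borel_measurable borel"
proof -
  note [measurable] = L2_space_measurable[OF fourier_in_L2[OF assms]]
  show ?thesis unfolding sobolev_weighted_def[abs_def] by measurable
qed

subsection \<open>The exponential filter\<close>

text \<open>For \<open>\<alpha> r \<le> 1\<close> the bound \<open>1 - exp (- x) \<le> x\<close> and
  \<open>q \<le> s\<close> give the rate \<open>(\<alpha> r) powr q\<close>; for larger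
  \<open>\<alpha> r\<close> this power is at least 1. Saturation of the filter at order
  \<open>s\<close> is the source of the conditions \<open>p + 2 - l \<le> s\<close> and
  \<open>p - l \<le> s\<close>.\<close>

lemma exp_filter_bias_le:
  fixes \<alpha> \<tau> r s q :: real
  assumes "0 < \<alpha>" "0 < \<tau>" "0 \<le> r" "0 \<le> q" "q \<le> s" "0 < s"
  shows "1 - exp (- \<tau> * (\<alpha> * r) powr s) \<le> max 1 \<tau> * (\<alpha> powr q * (1 + r\<^sup>2) powr (q / 2))"
proof -
  have "r powr q \<le> (1 + r\<^sup>2) powr (q / 2)"
  proof (cases "r = 0")
    case False
    then have "r powr q = (r\<^sup>2) powr (q / 2)"
      using assms by (simp add: powr_powr flip: powr_numeral)
    also have "\<dots> \<le> (1 + r\<^sup>2) powr (q / 2)"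
      using assms by (intro powr_mono2) auto
    finally show ?thesis .
  qed simp
  then have q: "(\<alpha> * r) powr q \<le> \<alpha> powr q * (1 + r\<^sup>2) powr (q / 2)"
    using assms by (simp add: powr_mult mult_left_mono)
  have "1 - exp (- \<tau> * (\<alpha> * r) powr s) \<le> max 1 \<tau> * (\<alpha> * r) powr q"
  proof (cases "\<alpha> * r \<le> 1")
    case True
    have "1 - exp (- \<tau> * (\<alpha> * r) powr s) \<le> \<tau> * (\<alpha> * r) powr s"
      using exp_ge_add_one_self[of "- \<tau> * (\<alpha> * r) powr s"] by simp
    also have "(\<alpha> * r) powr s \<le> (\<alpha> * r) powr q"
    proof (cases "r = 0")
      case False
      then show ?thesis using assms True by (intro powr_mono') auto
    qed (use assms in simp)
    then have "\<tau> * (\<alpha> * r) powr s \<le> max 1 \<tau> * (\<alpha> * r) powr q"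
      using assms by (intro mult_mono) auto
    finally show ?thesis .
  next
    case False
    then have "1 \<le> (\<alpha> * r) powr q"
      using assms by (intro ge_one_powr_ge_zero) auto
    then have "1 * 1 \<le> max 1 \<tau> * (\<alpha> * r) powr q"
      by (intro mult_mono) auto
    then show ?thesis
      by (smt (verit) exp_gt_zero)
  qed
  also have "\<dots> \<le> max 1 \<tau> * (\<alpha> powr q * (1 + r\<^sup>2) powr (q / 2))"
    using q by (intro mult_left_mono) auto
  finally show ?thesis .
qed

text \<open>After the substitution \<open>y = \<alpha> r\<close> the weight is at most a power of
  \<open>c + y^2\<close>, which the exponential dominates, so one \<open>B\<close> serves all orders
  up to \<open>P\<close>. At \<open>r = 0\<close> the claim reads
  \<open>1 \<le> B * \<alpha> powr (- \<kappa>)\<close>, which forces an upper bound on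
  \<open>\<alpha>\<close> when \<open>\<kappa> > 0\<close>.\<close>

lemma exp_filter_damping:
  fixes \<tau> s A P :: real
  assumes "0 < \<tau>" "0 < s" "0 \<le> P"
  obtains B where "1 \<le> B"
    "\<And>\<kappa> \<alpha> r. \<lbrakk>0 \<le> \<kappa>; \<kappa> \<le> P; 0 < \<alpha>; \<kappa> > 0 \<Longrightarrow> \<alpha> \<le> A; 0 \<le> r\<rbrakk>
      \<Longrightarrow> (1 + r\<^sup>2) powr (\<kappa> / 2) * exp (- \<tau> * (\<alpha> * r) powr s) \<le> B * \<alpha> powr (- \<kappa>)"
proof -
  \<comment> \<open>\<open>A^2\<close> dominates \<open>\<alpha>^2\<close>, and the 1 keeps the base
    at least 1, so that the exponent \<open>\<kappa> / 2\<close> may be raised to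
    \<open>P / 2\<close>.\<close>
  define c where "c = 1 + A\<^sup>2"
  have c: "1 \<le> c" by (simp add: c_def)
  have "((\<lambda>y. (c + y\<^sup>2) powr (P / 2) * exp (- \<tau> * y powr s)) \<longlongrightarrow> 0) at_top"
    using assms c by real_asymp
  then have "\<forall>\<^sub>F y in at_top. (c + y\<^sup>2) powr (P / 2) * exp (- \<tau> * y powr s) < 1"
    by (rule order_tendstoD) simp
  then obtain Y where Y: "\<And>y. Y \<le> y \<Longrightarrow> (c + y\<^sup>2) powr (P / 2) * exp (- \<tau> * y powr s) < 1"
    by (auto simp: eventually_at_top_linorder)
  \<comment> \<open>Beyond \<open>Y\<close> the product is below 1; up to \<open>Y\<close> the
    weight is at most its value at \<open>Y\<close> and the exponential is at most 1.\<close>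
  define B where "B = 1 + (c + Y\<^sup>2) powr (P / 2)"
  have B: "(c + y\<^sup>2) powr (P / 2) * exp (- \<tau> * y powr s) \<le> B" if "0 \<le> y" for y
  proof (cases "Y \<le> y")
    case True
    then show ?thesis using Y[OF True] powr_ge_zero[of "c + Y\<^sup>2" "P / 2"] unfolding B_def by linarith
  next
    case False
    then have "y\<^sup>2 \<le> Y\<^sup>2" using that by (intro power_mono) auto
    then have "(c + y\<^sup>2) powr (P / 2) \<le> (c + Y\<^sup>2) powr (P / 2)"
      using assms c by (intro powr_mono2) auto
    moreover have "exp (- \<tau> * y powr s) \<le> 1" using assms by simp
    ultimately have "(c + y\<^sup>2) powr (P / 2) * exp (- \<tau> * y powr s) \<le> (c + Y\<^sup>2) powr (P / 2) * 1"
      by (intro mult_mono) auto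
    then show ?thesis by (simp add: B_def)
  qed
  show ?thesis
  proof
    show "1 \<le> B" by (simp add: B_def)
    fix \<kappa> \<alpha> r :: real
    assume *: "0 \<le> \<kappa>" "\<kappa> \<le> P" "0 < \<alpha>" "\<kappa> > 0 \<Longrightarrow> \<alpha> \<le> A" "0 \<le> r"
    show "(1 + r\<^sup>2) powr (\<kappa> / 2) * exp (- \<tau> * (\<alpha> * r) powr s) \<le> B * \<alpha> powr (- \<kappa>)"
    proof (cases "\<kappa> = 0")
      case True
      have "exp (- \<tau> * (\<alpha> * r) powr s) \<le> 1" using assms by simp
      also have "1 \<le> B" by (simp add: B_def)
      finally have "exp (- \<tau> * (\<alpha> * r) powr s) \<le> B" .
      moreover have "(1 + r\<^sup>2) powr (\<kappa> / 2) = 1"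
        using True sum_power2_gt_zero_iff[of 1 r] by (simp add: less_imp_neq[symmetric])
      ultimately show ?thesis using True * by simp
    next
      case False
      with * have "\<alpha>\<^sup>2 \<le> A\<^sup>2" by (intro power_mono) auto
      have "\<alpha> powr \<kappa> * (1 + r\<^sup>2) powr (\<kappa> / 2) = (\<alpha>\<^sup>2) powr (\<kappa> / 2) * (1 + r\<^sup>2) powr (\<kappa> / 2)"
        using * by (simp add: powr_powr flip: powr_numeral)
      also have "\<dots> = (\<alpha>\<^sup>2 + (\<alpha> * r)\<^sup>2) powr (\<kappa> / 2)"
        by (subst powr_mult[symmetric]) (simp_all add: algebra_simps power_mult_distrib)
      also have "\<dots> \<le> (c + (\<alpha> * r)\<^sup>2) powr (\<kappa> / 2)"
        using * \<open>\<alpha>\<^sup>2 \<le> A\<^sup>2\<close> by (intro powr_mono2) (auto simp: c_def)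
      also have "\<dots> \<le> (c + (\<alpha> * r)\<^sup>2) powr (P / 2)"
        using * c by (intro powr_mono) (auto intro: add_increasing2)
      finally have "\<alpha> powr \<kappa> * (1 + r\<^sup>2) powr (\<kappa> / 2) * exp (- \<tau> * (\<alpha> * r) powr s)
          \<le> (c + (\<alpha> * r)\<^sup>2) powr (P / 2) * exp (- \<tau> * (\<alpha> * r) powr s)"
        by (intro mult_right_mono) auto
      also have "\<dots> \<le> B" using * by (intro B) simp
      finally show ?thesis
        using * by (simp add: powr_minus field_simps)
    qed
  qed
qed

subsection \<open>The error estimate in frequency space\<close>

text \<open>The common core of both estimates. The exponent \<open>m\<close> records the assumed
  decay in frequency of the Mittag-Leffler factor at time \<open>t\<close>: it will be 2 with a
  constant of order \<open>t powr (- \<gamma>)\<close>, or 0 with constant 1. The right-hand side of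
  the data bound becomes \<open>\<delta>\<close> under the choice of
  \<open>\<alpha>\<close>.\<close>

lemma regularization_error:
  fixes u v :: "real ^ 'n \<Rightarrow> real \<Rightarrow> complex" and g\<delta> :: "real ^ 'n \<Rightarrow> complex"
    and \<gamma> T \<tau> s \<alpha> :: real
  defines "e \<equiv> \<lambda>t r. mittag_leffler \<gamma> 1 (- (r\<^sup>2 * t powr \<gamma>))"
  assumes pos: "0 < \<tau>" "0 < s" "0 < \<alpha>"
    and u: "frac_diffusion_solution \<gamma> T u" and v: "regularized_solution \<gamma> T \<tau> s \<alpha> g\<delta> v"
    and g\<delta>: "g\<delta> \<in> L2_space" and data: "L2_norm (\<lambda>x. u x T - g\<delta> x) \<le> \<alpha> powr (p + 2) * E"
    and u0: "(\<lambda>x. u x 0) \<in> sobolev_space p" "sobolev_norm p (\<lambda>x. u x 0) \<le> E"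
    and t: "0 < t" "t \<le> T"
    and e_T: "\<And>r. 0 < e T r \<and> 1 / e T r \<le> K' * (1 + r\<^sup>2)" and "0 \<le> K'"
    and e_t: "\<And>r. 0 \<le> e t r \<and> e t r \<le> K * (1 + r\<^sup>2) powr (- m / 2)" and "0 \<le> K"
    and \<kappa>: "0 \<le> \<kappa>" "\<kappa> \<le> p + 2" "p + 2 - \<kappa> \<le> s"
    and B: "\<And>r. 0 \<le> r \<Longrightarrow> (1 + r\<^sup>2) powr (\<kappa> / 2) * exp (- \<tau> * (\<alpha> * r) powr s) \<le> B * \<alpha> powr (- \<kappa>)"
      "0 \<le> B"
  shows "(\<lambda>x. u x t - v x t) \<in> sobolev_space (\<kappa> + m - 2)"
    and "sobolev_norm (\<kappa> + m - 2) (\<lambda>x. u x t - v x t)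
      \<le> 2 * K * (max 1 \<tau> + K' * B) * (\<alpha> powr (p + 2 - \<kappa>) * E)"
proof -
  define q where "q = p + 2 - \<kappa>"
  define l where "l = \<kappa> + m - 2"
  have T: "0 \<le> T" using t by simp
  have L2: "(\<lambda>x. u x t) \<in> L2_space" "(\<lambda>x. u x T) \<in> L2_space" "(\<lambda>x. v x t) \<in> L2_space"
    "(\<lambda>x. u x 0) \<in> L2_space" "sobolev_weighted p (\<lambda>x. u x 0) \<in> L2_space"
    using u v t T u0 by (auto simp: frac_diffusion_solution_def regularized_solution_def sobolev_space_def)
  note L2_diff = L2_space_diff[OF L2(1,3)] L2_space_diff[OF L2(2) g\<delta>]
  define \<rho> where "\<rho> r = exp (- \<tau> * (\<alpha> * r) powr s)" for r
  let ?D = "fourier (\<lambda>x. u x T - g\<delta> x)" and ?U = "sobolev_weighted p (\<lambda>x. u x 0)"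
  \<comment> \<open>\<open>a\<close> belongs to the bias of the filter, \<open>b\<close> to the
    amplified data error.\<close>
  define a where "a = K * (max 1 \<tau> * \<alpha> powr q)"
  define b where "b = K * (K' * (B * \<alpha> powr (- \<kappa>)))"
  have "AE \<xi> in lborel. fourier (\<lambda>x. u x t) \<xi> = fourier (\<lambda>x. u x 0) \<xi> * of_real (e t (norm \<xi>))"
    "AE \<xi> in lborel. fourier (\<lambda>x. u x T) \<xi> = fourier (\<lambda>x. u x 0) \<xi> * of_real (e T (norm \<xi>))"
    using u t T by (auto simp: frac_diffusion_solution_def e_def)
  moreover have "AE \<xi> in lborel. fourier (\<lambda>x. v x t) \<xi> =
      of_real (e t (norm \<xi>) / e T (norm \<xi>) * \<rho> (norm \<xi>)) * fourier g\<delta> \<xi>"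
    using v t by (auto simp: regularized_solution_def e_def \<rho>_def)
  ultimately have "AE \<xi> in lborel. norm (sobolev_weighted l (\<lambda>x. u x t - v x t) \<xi>)
      \<le> a * norm (?U \<xi>) + b * norm (?D \<xi>)"
    using fourier_diff_AE[OF L2(1,3)] fourier_diff_AE[OF L2(2) g\<delta>]
  proof eventually_elim
    case (elim \<xi>)
    define r where "r = norm \<xi>"
    define w where "w = 1 + r\<^sup>2"
    have r: "0 \<le> r" and w: "0 < w"
      by (simp_all add: r_def w_def add_pos_nonneg)
    have et: "0 \<le> e t r" "e t r \<le> K * w powr (- m / 2)" and eT: "0 < e T r" "1 / e T r \<le> K' * w"
      using e_t[of r] e_T[of r] by (auto simp: w_def)
    have \<rho>: "0 \<le> 1 - \<rho> r" "0 \<le> \<rho> r" using pos by (auto simp: \<rho>_def)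
    let ?ini = "fourier (\<lambda>x. u x 0) \<xi>"
    have triangle: "norm (of_real c * z + of_real c' * z') \<le> c * norm z + c' * norm z'"
      if "0 \<le> c" "0 \<le> c'" for c c' and z z' :: complex
      by (rule norm_triangle_le) (simp add: norm_mult that)
    \<comment> \<open>The transform of \<open>g\<delta>\<close> is that of \<open>u\<close> at time
      \<open>T\<close> minus \<open>?D\<close>; the former equals \<open>e T r * ?ini\<close>, so
      \<open>e T r\<close> cancels in the bias term.\<close>
    have "fourier (\<lambda>x. u x t - v x t) \<xi> =
        of_real (e t r * (1 - \<rho> r)) * ?ini + of_real (e t r * (1 / e T r) * \<rho> r) * ?D \<xi>"
      unfolding elim(4,5) elim(1-3) r_def[symmetric] using eT(1) by (simp add: field_simps)
    then have "norm (fourier (\<lambda>x. u x t - v x t) \<xi>)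
        \<le> e t r * (1 - \<rho> r) * norm ?ini + e t r * (1 / e T r) * \<rho> r * norm (?D \<xi>)"
      using et(1) eT(1) \<rho> by (simp only: triangle mult_nonneg_nonneg zero_le_divide_1_iff less_imp_le)
    then have "norm (sobolev_weighted l (\<lambda>x. u x t - v x t) \<xi>)
        \<le> w powr (l / 2) * (e t r * (1 - \<rho> r) * norm ?ini + e t r * (1 / e T r) * \<rho> r * norm (?D \<xi>))"
      by (simp add: sobolev_weighted_def norm_mult w_def r_def mult_left_mono)
    also have "\<dots> = (w powr (l / 2) * (e t r * (1 - \<rho> r))) * norm ?ini
        + (w powr (l / 2) * (e t r * (1 / e T r) * \<rho> r)) * norm (?D \<xi>)"
      by (simp add: distrib_left)
    also have "\<dots> \<le> (a * w powr (p / 2)) * norm ?ini + b * norm (?D \<xi>)"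
    proof (intro add_mono mult_right_mono norm_ge_zero)
      have "1 - \<rho> r \<le> max 1 \<tau> * (\<alpha> powr q * w powr (q / 2))"
        unfolding \<rho>_def w_def using pos \<kappa> r by (intro exp_filter_bias_le) (auto simp: q_def)
      then have "w powr (l / 2) * (e t r * (1 - \<rho> r))
          \<le> w powr (l / 2) * ((K * w powr (- m / 2)) * (max 1 \<tau> * (\<alpha> powr q * w powr (q / 2))))"
        using et \<rho> by (intro mult_left_mono mult_mono) auto
      also have "\<dots> = a * (w powr (l / 2) * w powr (- m / 2) * w powr (q / 2))"
        by (simp add: a_def)
      \<comment> \<open>The exponents satisfy \<open>l - m + q = p\<close>, which leaves the weight
        of the initial value.\<close>
      also have "w powr (l / 2) * w powr (- m / 2) * w powr (q / 2) = w powr (p / 2)"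
        unfolding powr_add[symmetric] by (simp add: l_def q_def field_simps)
      finally show "w powr (l / 2) * (e t r * (1 - \<rho> r)) \<le> a * w powr (p / 2)" .
      have "w powr (l / 2) * (e t r * (1 / e T r) * \<rho> r)
          \<le> w powr (l / 2) * ((K * w powr (- m / 2)) * (K' * w) * \<rho> r)"
        using et eT \<rho> by (intro mult_left_mono mult_right_mono mult_mono) auto
      also have "\<dots> = K * (K' * ((w powr (l / 2) * w powr (- m / 2) * w powr 1) * \<rho> r))"
        using w by simp
      \<comment> \<open>Here \<open>l - m + 2 = \<kappa>\<close>; the additional factor
        \<open>w\<close> comes from dividing by \<open>e T r\<close>.\<close>
      also have "w powr (l / 2) * w powr (- m / 2) * w powr 1 = w powr (\<kappa> / 2)"
        unfolding powr_add[symmetric] by (simp add: l_def field_simps)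
      also have "K * (K' * (w powr (\<kappa> / 2) * \<rho> r)) \<le> b"
        unfolding b_def \<rho>_def w_def using B(1)[OF r] \<open>0 \<le> K\<close> \<open>0 \<le> K'\<close>
        by (intro mult_left_mono)
      finally show "w powr (l / 2) * (e t r * (1 / e T r) * \<rho> r) \<le> b" .
    qed
    also have "(a * w powr (p / 2)) * norm ?ini = a * norm (?U \<xi>)"
      by (simp add: sobolev_weighted_def norm_mult w_def r_def)
    finally show ?case .
  qed
  moreover have "0 \<le> a" "0 \<le> b"
    using \<open>0 \<le> K\<close> \<open>0 \<le> K'\<close> B(2) by (auto simp: a_def b_def)
  moreover have "L2_norm ?D \<le> \<alpha> powr (p + 2) * E"
    using L2_norm_fourier_le[OF L2_diff(2)] data by simp
  moreover have "L2_norm ?U \<le> E" using u0 by (simp add: sobolev_norm_def)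
  ultimately have W: "sobolev_weighted l (\<lambda>x. u x t - v x t) \<in> L2_space"
    "L2_norm (sobolev_weighted l (\<lambda>x. u x t - v x t)) \<le> 2 * (a * E + b * (\<alpha> powr (p + 2) * E))"
    using L2_dominated_sum[OF measurable_sobolev_weighted[OF L2_diff(1)] L2(5) fourier_in_L2[OF L2_diff(2)]]
    by blast+
  \<comment> \<open>The damping bound contributes \<open>\<alpha> powr (- \<kappa>)\<close> to the
    data error, so both terms acquire the same rate \<open>\<alpha> powr q * E\<close>.\<close>
  have "\<alpha> powr (- \<kappa>) * \<alpha> powr (p + 2) = \<alpha> powr q"
    unfolding powr_add[symmetric] by (simp add: q_def)
  then have "b * (\<alpha> powr (p + 2) * E) = K * (K' * B) * (\<alpha> powr q * E)"
    by (simp add: b_def mult.assoc mult.left_commute[of _ "\<alpha> powr (- \<kappa>)"])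
  then have eq: "2 * (a * E + b * (\<alpha> powr (p + 2) * E)) = 2 * K * (max 1 \<tau> + K' * B) * (\<alpha> powr q * E)"
    by (simp add: a_def algebra_simps)
  show "(\<lambda>x. u x t - v x t) \<in> sobolev_space (\<kappa> + m - 2)"
    using W(1) L2_diff(1) by (simp add: sobolev_space_def l_def)
  show "sobolev_norm (\<kappa> + m - 2) (\<lambda>x. u x t - v x t)
      \<le> 2 * K * (max 1 \<tau> + K' * B) * (\<alpha> powr (p + 2 - \<kappa>) * E)"
    using W(2) unfolding eq by (simp add: sobolev_norm_def l_def q_def)
qed

section \<open>Time-dependent constants and the final assembly\<close>

lemma mittag_leffler_frequency_bounds:
  fixes \<gamma> T t r :: real
  assumes \<gamma>: "0 < \<gamma>" "\<gamma> < 1" and t: "0 < t" "t \<le> T"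
  defines "x \<equiv> r\<^sup>2 * t powr \<gamma>"
  shows "0 < mittag_leffler \<gamma> 1 (- x)" and "mittag_leffler \<gamma> 1 (- x) \<le> 1"
    and "mittag_leffler \<gamma> 1 (- x) \<le> (T powr \<gamma> + Gamma (1 + \<gamma>)) / t powr \<gamma> / (1 + r\<^sup>2)"
    and "1 / mittag_leffler \<gamma> 1 (- x) \<le> (1 + t powr \<gamma> * Gamma (1 - \<gamma>)) * (1 + r\<^sup>2)"
proof -
  have G: "0 < Gamma (1 - \<gamma>)" "0 < Gamma (1 + \<gamma>)"
    using \<gamma> by (auto intro!: Gamma_real_pos)
  have x: "0 \<le> x" by (simp add: x_def)
  note bounds = mittag_leffler_bounds[OF \<gamma> x]
  have low: "0 < 1 / (1 + x * Gamma (1 - \<gamma>))"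
    using x G by (simp add: add_pos_nonneg)
  show pos: "0 < mittag_leffler \<gamma> 1 (- x)"
    using low bounds(1) by linarith
  have "1 / (1 + x / Gamma (1 + \<gamma>)) \<le> 1"
    using x G by (simp add: divide_le_eq_1 add_pos_nonneg)
  then show "mittag_leffler \<gamma> 1 (- x) \<le> 1"
    using bounds(2) by linarith
  have t': "0 < t powr \<gamma>" "t powr \<gamma> \<le> T powr \<gamma>"
    using t \<gamma> by (auto intro!: powr_mono2)
  have r: "0 < 1 + r\<^sup>2" by (simp add: add_pos_nonneg)
  have "t powr \<gamma> * (1 + r\<^sup>2) \<le> T powr \<gamma> + x"
    using t' by (simp add: x_def algebra_simps)
  \<comment> \<open>The added nonnegative terms complete the product that follows, whose second
    factor is the denominator of the upper Mittag-Leffler bound.\<close>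
  also have "\<dots> \<le> T powr \<gamma> + x + (Gamma (1 + \<gamma>) + T powr \<gamma> * x / Gamma (1 + \<gamma>))"
    using G x by simp
  also have "\<dots> = (T powr \<gamma> + Gamma (1 + \<gamma>)) * (1 + x / Gamma (1 + \<gamma>))"
    using G by (simp add: field_simps)
  finally have "1 / (1 + x / Gamma (1 + \<gamma>)) \<le> (T powr \<gamma> + Gamma (1 + \<gamma>)) / t powr \<gamma> / (1 + r\<^sup>2)"
    using G x t' r by (simp add: divide_simps add_pos_nonneg mult_ac split: if_splits)
  then show "mittag_leffler \<gamma> 1 (- x) \<le> (T powr \<gamma> + Gamma (1 + \<gamma>)) / t powr \<gamma> / (1 + r\<^sup>2)"
    using bounds(2) by linarith
  have "1 / mittag_leffler \<gamma> 1 (- x) \<le> 1 + x * Gamma (1 - \<gamma>)"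
    using bounds(1) low pos x G by (simp add: divide_simps add_pos_nonneg mult.commute split: if_splits)
  also have "\<dots> \<le> (1 + t powr \<gamma> * Gamma (1 - \<gamma>)) * (1 + r\<^sup>2)"
    using t' G by (simp add: x_def algebra_simps)
  finally show "1 / mittag_leffler \<gamma> 1 (- x) \<le> (1 + t powr \<gamma> * Gamma (1 - \<gamma>)) * (1 + r\<^sup>2)" .
qed

theorem theorem2:
  fixes \<gamma> T \<tau> s p M :: real
  assumes "0 < \<gamma>" "\<gamma> < 1" "T > 0" "\<tau> > 0" "s > 0" "p > 0" "M > 0"
  shows "\<exists>C C'. \<forall>E \<delta> (u :: real ^ 'n \<Rightarrow> real \<Rightarrow> complex) g g\<delta> v.
    E > 0 \<and> \<delta> > 0 \<and>
    frac_diffusion_solution \<gamma> T u \<and>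
    g \<in> L2_space \<and> (AE x in lborel. u x T = g x) \<and>
    (\<lambda>x. u x 0) \<in> sobolev_space p \<and> sobolev_norm p (\<lambda>x. u x 0) \<le> E \<and>
    g\<delta> \<in> L2_space \<and> L2_norm (\<lambda>x. g x - g\<delta> x) \<le> \<delta> \<and>
    regularized_solution \<gamma> T \<tau> s ((\<delta> / E) powr (1 / (p + 2))) g\<delta> v \<longrightarrow>
    (\<forall>t\<in>{0<..T}. \<forall>l\<in>{0..p + 2}. p + 2 - l \<le> s \<and> (l > 0 \<longrightarrow> \<delta> \<le> M * E) \<longrightarrow>
       (\<lambda>x. u x t - v x t) \<in> sobolev_space l \<and>
       sobolev_norm l (\<lambda>x. u x t - v x t)
         \<le> C / t powr \<gamma> * E powr (l / (p + 2)) * \<delta> powr (1 - l / (p + 2))) \<and>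
    (\<forall>t\<in>{0<..T}. \<forall>l\<in>{0..p}. p - l \<le> s \<and> \<delta> \<le> M * E \<longrightarrow>
       (\<lambda>x. u x t - v x t) \<in> sobolev_space l \<and>
       sobolev_norm l (\<lambda>x. u x t - v x t)
         \<le> C' * E powr ((2 + l) / (p + 2)) * \<delta> powr ((p - l) / (p + 2)))"
proof -
  define P where "P = p + 2"
  have P: "0 < P" using assms by (simp add: P_def)
  define K' where "K' = 1 + T powr \<gamma> * Gamma (1 - \<gamma>)"
  have "0 < Gamma (1 - \<gamma>)" "0 < Gamma (1 + \<gamma>)"
    using assms by (auto intro!: Gamma_real_pos)
  then have K': "0 \<le> K'" by (simp add: K'_def)
  \<comment> \<open>\<open>\<delta> \<le> M * E\<close> becomes
    \<open>\<alpha> \<le> M powr (1 / P)\<close>, and \<open>P\<close> is the largest order that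
    occurs, so one \<open>B\<close> serves all \<open>l\<close>.\<close>
  obtain B where B: "1 \<le> B"
    "\<And>\<kappa> \<alpha> r. \<lbrakk>0 \<le> \<kappa>; \<kappa> \<le> P; 0 < \<alpha>; \<kappa> > 0 \<Longrightarrow> \<alpha> \<le> M powr (1 / P); 0 \<le> r\<rbrakk>
      \<Longrightarrow> (1 + r\<^sup>2) powr (\<kappa> / 2) * exp (- \<tau> * (\<alpha> * r) powr s) \<le> B * \<alpha> powr (- \<kappa>)"
    using exp_filter_damping[of \<tau> s P "M powr (1 / P)"] assms P by (metis less_imp_le)
  define L where "L = 2 * (max 1 \<tau> + K' * B)"
  define K where "K = T powr \<gamma> + Gamma (1 + \<gamma>)"
  \<comment> \<open>Both claims are instances: \<open>N\<close> and \<open>m\<close> describe the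
    Mittag-Leffler factor at time \<open>t\<close>, and \<open>\<kappa>\<close> fixes the powers of
    \<open>E\<close> and \<open>\<delta>\<close>.\<close>
  have core: "(\<lambda>x. u x t - v x t) \<in> sobolev_space (\<kappa> + m - 2) \<and>
      sobolev_norm (\<kappa> + m - 2) (\<lambda>x. u x t - v x t) \<le> N * L * (E powr (\<kappa> / P) * \<delta> powr (1 - \<kappa> / P))"
    if pos: "0 < E" "0 < \<delta>" and u: "frac_diffusion_solution \<gamma> T u"
      and g: "g \<in> L2_space" "AE x in lborel. u x T = g x"
      and u0: "(\<lambda>x. u x 0) \<in> sobolev_space p" "sobolev_norm p (\<lambda>x. u x 0) \<le> E"
      and g\<delta>: "g\<delta> \<in> L2_space" "L2_norm (\<lambda>x. g x - g\<delta> x) \<le> \<delta>"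
      and v: "regularized_solution \<gamma> T \<tau> s ((\<delta> / E) powr (1 / (p + 2))) g\<delta> v"
      and t: "0 < t" "t \<le> T" and \<kappa>: "0 \<le> \<kappa>" "\<kappa> \<le> P" "P - \<kappa> \<le> s" "\<kappa> > 0 \<Longrightarrow> \<delta> \<le> M * E"
      and N: "0 \<le> N" "\<And>r. mittag_leffler \<gamma> 1 (- (r\<^sup>2 * t powr \<gamma>)) \<le> N * (1 + r\<^sup>2) powr (- m / 2)"
    for E \<delta> t \<kappa> m N and u :: "real ^ 'n \<Rightarrow> real \<Rightarrow> complex" and g g\<delta> v
  proof -
    define \<alpha> where "\<alpha> = (\<delta> / E) powr (1 / P)"
    have \<alpha>: "0 < \<alpha>" using pos by (simp add: \<alpha>_def)
    \<comment> \<open>At \<open>q = P\<close> the value is \<open>\<delta>\<close>, the data bound;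
      at \<open>q = P - \<kappa>\<close> it is the final rate.\<close>
    have \<alpha>_powr: "\<alpha> powr q * E = E powr (1 - q / P) * \<delta> powr (q / P)" for q
    proof -
      have "\<alpha> powr q * E = \<delta> powr (q / P) * (E powr 1 / E powr (q / P))"
        using pos by (simp add: \<alpha>_def powr_powr powr_divide)
      also have "E powr 1 / E powr (q / P) = E powr (1 - q / P)"
        by (rule powr_diff[symmetric])
      finally show ?thesis by simp
    qed
    have "(\<lambda>x. u x T) \<in> L2_space"
      using u assms by (auto simp: frac_diffusion_solution_def)
    then have "L2_norm (\<lambda>x. u x T - g\<delta> x) = L2_norm (\<lambda>x. g x - g\<delta> x)"
      using g g\<delta> by (intro L2_norm_cong_AE L2_space_diff) auto
    moreover have "\<alpha> powr (p + 2) * E = \<delta>"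
      using \<alpha>_powr[of P] P pos by (simp add: P_def)
    ultimately have data: "L2_norm (\<lambda>x. u x T - g\<delta> x) \<le> \<alpha> powr (p + 2) * E"
      using g\<delta> by simp
    have damping: "(1 + r\<^sup>2) powr (\<kappa> / 2) * exp (- \<tau> * (\<alpha> * r) powr s) \<le> B * \<alpha> powr (- \<kappa>)"
      if "0 \<le> r" for r
    proof (rule B(2)[OF \<kappa>(1,2) \<alpha> _ that])
      assume "\<kappa> > 0"
      then show "\<alpha> \<le> M powr (1 / P)"
        using \<kappa>(4) pos P unfolding \<alpha>_def by (intro powr_mono2) (auto simp: divide_le_eq)
    qed
    note ml = mittag_leffler_frequency_bounds[OF assms(1,2)]
    have bound_eq: "2 * N * (max 1 \<tau> + K' * B) * (\<alpha> powr (p + 2 - \<kappa>) * E) =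
        N * L * (E powr (\<kappa> / P) * \<delta> powr (1 - \<kappa> / P))"
    proof -
      have "1 - (P - \<kappa>) / P = \<kappa> / P" "(P - \<kappa>) / P = 1 - \<kappa> / P"
        using P by (simp_all add: diff_divide_distrib)
      then have "\<alpha> powr (P - \<kappa>) * E = E powr (\<kappa> / P) * \<delta> powr (1 - \<kappa> / P)"
        unfolding \<alpha>_powr by simp
      then show ?thesis by (simp add: L_def P_def)
    qed
    note err = regularization_error[where K = N and K' = K' and B = B and m = m and \<kappa> = \<kappa>,
        OF assms(4,5) \<alpha> u v[folded P_def, folded \<alpha>_def] g\<delta>(1) data u0 t _ K' _ N(1) \<kappa>(1)]
    have "(\<lambda>x. u x t - v x t) \<in> sobolev_space (\<kappa> + m - 2) \<and>
        sobolev_norm (\<kappa> + m - 2) (\<lambda>x. u x t - v x t)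
          \<le> 2 * N * (max 1 \<tau> + K' * B) * (\<alpha> powr (p + 2 - \<kappa>) * E)"
      using err ml(1,4)[OF assms(3) order_refl] ml(1)[OF t] N(2) \<kappa>(2,3) damping B(1)
      by (simp add: P_def K'_def less_imp_le)
    then show ?thesis unfolding bound_eq .
  qed
  show ?thesis
  \<comment> \<open>The constants depend on \<open>M\<close> through \<open>B\<close>, but on
    neither \<open>E\<close> nor \<open>\<delta>\<close>; neither involves \<open>t\<close>.\<close>
  proof (rule exI[of _ "K * L"], rule exI[of _ L], intro allI impI, elim conjE, intro conjI ballI impI)
    fix E \<delta> :: real and u :: "real ^ 'n \<Rightarrow> real \<Rightarrow> complex" and g g\<delta> v t l
    assume *: "0 < E" "0 < \<delta>" "frac_diffusion_solution \<gamma> T u"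
      "g \<in> L2_space" "AE x in lborel. u x T = g x"
      "(\<lambda>x. u x 0) \<in> sobolev_space p" "sobolev_norm p (\<lambda>x. u x 0) \<le> E"
      "g\<delta> \<in> L2_space" "L2_norm (\<lambda>x. g x - g\<delta> x) \<le> \<delta>"
      "regularized_solution \<gamma> T \<tau> s ((\<delta> / E) powr (1 / (p + 2))) g\<delta> v"
      and "t \<in> {0<..T}"
    then have t: "0 < t" "t \<le> T" by auto
    note ml = mittag_leffler_frequency_bounds[OF assms(1,2) t]
    have w: "0 < 1 + r\<^sup>2" for r :: real by (simp add: add_pos_nonneg)
    {
      assume l: "l \<in> {0..p + 2}" "p + 2 - l \<le> s \<and> (l > 0 \<longrightarrow> \<delta> \<le> M * E)"
      \<comment> \<open>Estimate (i): \<open>\<kappa> = l\<close> and \<open>m = 2\<close>, where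
        the decay in frequency costs the factor \<open>1 / t powr \<gamma>\<close>.\<close>
      have "mittag_leffler \<gamma> 1 (- (r\<^sup>2 * t powr \<gamma>)) \<le> K / t powr \<gamma> * (1 + r\<^sup>2) powr (- 2 / 2)" for r
      proof -
        have "(1 + r\<^sup>2) powr (- 2 / 2) = 1 / (1 + r\<^sup>2)"
          using w[of r] by (simp add: powr_minus_divide)
        then show ?thesis using ml(3)[of r] unfolding K_def by simp
      qed
      moreover have "0 \<le> K / t powr \<gamma>"
        using \<open>0 < Gamma (1 + \<gamma>)\<close> by (simp add: K_def)
      moreover have "0 \<le> l" "l \<le> P" "P - l \<le> s" "0 < l \<Longrightarrow> \<delta> \<le> M * E"
        using l by (auto simp: P_def)
      ultimately have "(\<lambda>x. u x t - v x t) \<in> sobolev_space (l + 2 - 2) \<and>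
          sobolev_norm (l + 2 - 2) (\<lambda>x. u x t - v x t)
            \<le> K / t powr \<gamma> * L * (E powr (l / P) * \<delta> powr (1 - l / P))"
        by (intro core[OF * t])
      then show "(\<lambda>x. u x t - v x t) \<in> sobolev_space l"
        and "sobolev_norm l (\<lambda>x. u x t - v x t)
            \<le> K * L / t powr \<gamma> * E powr (l / (p + 2)) * \<delta> powr (1 - l / (p + 2))"
        by (simp_all add: P_def)
    next
      assume l: "l \<in> {0..p}" "p - l \<le> s \<and> \<delta> \<le> M * E"
      \<comment> \<open>Estimate (ii): \<open>\<kappa> = l + 2\<close> and \<open>m = 0\<close>,
        with a bound uniform in time. As \<open>\<kappa>\<close> is positive even for
        \<open>l = 0\<close>, the condition \<open>\<delta> \<le> M * E\<close> enters for every
        \<open>l\<close>.\<close>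
      have "mittag_leffler \<gamma> 1 (- (r\<^sup>2 * t powr \<gamma>)) \<le> 1 * (1 + r\<^sup>2) powr (- 0 / 2)" for r
        using ml(2)[of r] w[of r] by simp
      moreover have "0 \<le> l + 2" "l + 2 \<le> P" "P - (l + 2) \<le> s" "0 < l + 2 \<Longrightarrow> \<delta> \<le> M * E" "0 \<le> (1 :: real)"
        using l by (auto simp: P_def)
      ultimately have "(\<lambda>x. u x t - v x t) \<in> sobolev_space (l + 2 + 0 - 2) \<and>
          sobolev_norm (l + 2 + 0 - 2) (\<lambda>x. u x t - v x t)
            \<le> 1 * L * (E powr ((l + 2) / P) * \<delta> powr (1 - (l + 2) / P))"
        by (intro core[OF * t])
      moreover have "1 - (l + 2) / P = (p - l) / (p + 2)"
        using assms by (simp add: P_def field_simps)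
      ultimately show "(\<lambda>x. u x t - v x t) \<in> sobolev_space l"
        and "sobolev_norm l (\<lambda>x. u x t - v x t)
            \<le> L * E powr ((2 + l) / (p + 2)) * \<delta> powr ((p - l) / (p + 2))"
        by (simp_all add: P_def add.commute)
    }
  qed
qed

end
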